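(* Let $k$ be a positive integer and let $\pi$ be a $k$-homogeneous probability measure on $\mathcal{B}_n=\{0,1\}^n$ satisfying the strong Rayleigh property. Let $f\colon\mathcal{B}_n\to\mathcal{H}_d$ be such that there exist $C_1,\dots,C_n\in\mathcal{H}_d$ with \[ (f(x)-f(x^i))^2\preccurlyeq C_i^2\quad\text{for all }x\in\mathcal{B}_n,\ i\in[n]. \] Then for any $t>0$, \[ \pi\big(\lambda_{\max}(f-\pi(f))>t\big)\le d\exp\Big(-\frac{t^2}{8\|\pi(\tilde f)\|\log(ek)+\frac43 Kt}\Big), \] where $\tilde f(x)=\sum_{i=1}^n x_iC_i^2$ and $K=\max_{i\le n}\|C_i\|$.
   Context: $\mathcal{H}_d$ is the space of $d\times d$ Hermitian matrices, $\preccurlyeq$ the positive semidefinite order, $\|\cdot\|$ the operator norm, $\lambda_{\max}$ the largest eigenvalue, $\pi(g)=\int g\,d\pi$ (entrywise for matrix-valued $g$). $x^i$ denotes $x$ with its $i$-th coordinate flipped. A probability measure $\pi$ on $\mathcal{B}_n$ satisfies the strong Rayleigh property if its generating polynomial $z\mapsto\sum_{x\in\mathcal{B}_n}\pi(x)\prod_{i=1}^n z_i^{x_i}$ ($z\in\mathbb{C}^n$) has no zero $z$ all of whose coordinates lie in the open upper half-plane. $\pi$ is $k$-homogeneous if it is supported on vectors with exactly $k$ coordinates equal to $1$. *)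

theory Defs
  imports "HOL-Analysis.Analysis"
begin

text \<open>d x d complex matrices are represented as complex^'d^'d (d = CARD('d)).
  Points of the hypercube B_n are x :: 'n \<Rightarrow> bool (n = CARD('n)), x i = True meaning x_i = 1.\<close>

definition hermitian :: "complex^'d^'d \<Rightarrow> bool" where
  "hermitian A \<longleftrightarrow> (\<forall>i j. A $ i $ j = cnj (A $ j $ i))"

definition quad_form :: "complex^'d^'d \<Rightarrow> complex^'d \<Rightarrow> complex" where
  "quad_form A v = (\<Sum>i\<in>UNIV. cnj (v $ i) * (A *v v) $ i)"

definition psd :: "complex^'d^'d \<Rightarrow> bool" where
  "psd A \<longleftrightarrow> (\<forall>v. quad_form A v \<in> \<real> \<and> Re (quad_form A v) \<ge> 0)"

definition loewner_le :: "complex^'d^'d \<Rightarrow> complex^'d^'d \<Rightarrow> bool" (infix "\<preceq>\<^sub>L" 50) where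
  "A \<preceq>\<^sub>L B \<longleftrightarrow> psd (B - A)"

definition op_norm :: "complex^'d^'d \<Rightarrow> real" where
  "op_norm A = onorm (\<lambda>v. A *v v)"

definition lambda_max :: "complex^'d^'d \<Rightarrow> real" where
  "lambda_max A = Max {l::real. \<exists>v. v \<noteq> 0 \<and> A *v v = complex_of_real l *s v}"

definition flip :: "('n \<Rightarrow> bool) \<Rightarrow> 'n \<Rightarrow> ('n \<Rightarrow> bool)" where
  "flip x i = x(i := \<not> x i)"

definition prob_on_cube :: "(('n::finite \<Rightarrow> bool) \<Rightarrow> real) \<Rightarrow> bool" where
  "prob_on_cube \<pi> \<longleftrightarrow> (\<forall>x. \<pi> x \<ge> 0) \<and> (\<Sum>x\<in>UNIV. \<pi> x) = 1"

definition homogeneous :: "nat \<Rightarrow> (('n::finite \<Rightarrow> bool) \<Rightarrow> real) \<Rightarrow> bool" where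
  "homogeneous k \<pi> \<longleftrightarrow> (\<forall>x. \<pi> x \<noteq> 0 \<longrightarrow> card {i. x i} = k)"

definition gen_poly :: "(('n::finite \<Rightarrow> bool) \<Rightarrow> real) \<Rightarrow> ('n \<Rightarrow> complex) \<Rightarrow> complex" where
  "gen_poly \<pi> z = (\<Sum>x\<in>UNIV. complex_of_real (\<pi> x) * (\<Prod>i\<in>UNIV. z i ^ (if x i then 1 else 0)))"

definition strong_rayleigh :: "(('n::finite \<Rightarrow> bool) \<Rightarrow> real) \<Rightarrow> bool" where
  "strong_rayleigh \<pi> \<longleftrightarrow> (\<forall>z. (\<forall>i. Im (z i) > 0) \<longrightarrow> gen_poly \<pi> z \<noteq> 0)"

definition expect :: "(('n::finite \<Rightarrow> bool) \<Rightarrow> real) \<Rightarrow> (('n \<Rightarrow> bool) \<Rightarrow> complex^'d^'d) \<Rightarrow> complex^'d^'d" where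
  "expect \<pi> g = (\<Sum>x\<in>UNIV. \<pi> x *\<^sub>R g x)"

end

(*
  Reveal the k elements of the random set one after the other, in uniformly random order, and
  consider the Doob martingale of f. By the Feder-Mihail argument the strong Rayleigh property
  implies that conditioning on e \<in> S stochastically decreases the rest of S. Adding a linear function
  makes a Lipschitz function increasing, which bounds the increment D of the martingale at step j by
  ||D v|| <= ||C_e v|| + \<Sum>_l q_l ||C_l v|| with weights q_l that add up to 1 and measure how much
  the conditional probability of l \<in> S drops. Hence ||D|| <= 2 K, and averaging over e gives
  E[D^2] <= 4/(k-j+1) * \<pi>(f~), so that the quadratic variation is at most 4 H_k \<pi>(f~) with
  H_k <= log(e k). As all the bounds are multiples of one fixed matrix, the Golden-Thompson inequality
  (and not Lieb's theorem) suffices for the matrix Bernstein argument. It follows from the trace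
  inequality tr((S T)^N) <= tr(S^N T^N), N a power of 2, and the Lie-Trotter formula.

  Hermitian matrices are treated as self-adjoint operators on a real Euclidean space.
*)
theory Submission
  imports Defs
begin

section \<open>The Banach algebra of endomorphisms of a Euclidean space\<close>

text \<open>The Feder-Mihail argument speaks of real-valued functions, while the increments D are
  operators. It is therefore applied to S \<mapsto> u . F(S) v with u and v fixed; for u = D v the
  increment of this function is |D v|^2 and its Lipschitz constants are |u| |C_i v|, so that a
  factor |u| cancels. This is why the C_i enter through the norms |C_i v|.

  Splitting off one increment at a time by Golden-Thompson leaves an averaged exponential inside the
  trace. Here \<pi>(f~) is replaced by its norm, so that this average is bounded by a multiple of
  the identity, which leaves the trace as a scalar.

  The exponent is Bernstein's t^2 / (2 (\<sigma>^2 + R t / 3)) with R = 2 K and \<sigma>^2 = 4 log(e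
  k) ||\<pi>(f~)||.

  Operators form a type of their own so that composition is the multiplication of a Banach algebra,
  where powers and \<open>exp\<close> are available.\<close>

typedef (overloaded) 'a endo = "UNIV :: ('a::euclidean_space \<Rightarrow>\<^sub>L 'a) set"
  morphisms blinfun_of_endo endo_of_blinfun by simp

setup_lifting type_definition_endo

instantiation endo :: (euclidean_space) real_vector
begin

lift_definition zero_endo :: "'a endo" is 0 .
lift_definition plus_endo :: "'a endo \<Rightarrow> 'a endo \<Rightarrow> 'a endo" is "(+)" .
lift_definition minus_endo :: "'a endo \<Rightarrow> 'a endo \<Rightarrow> 'a endo" is "(-)" .
lift_definition uminus_endo :: "'a endo \<Rightarrow> 'a endo" is uminus .
lift_definition scaleR_endo :: "real \<Rightarrow> 'a endo \<Rightarrow> 'a endo" is scaleR .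

instance
  by standard (transfer; simp add: algebra_simps)+

end

instantiation endo :: (euclidean_space) real_normed_vector
begin

lift_definition norm_endo :: "'a endo \<Rightarrow> real" is norm .

definition dist_endo :: "'a endo \<Rightarrow> 'a endo \<Rightarrow> real" where
  "dist_endo A B = norm (A - B)"

definition sgn_endo :: "'a endo \<Rightarrow> 'a endo" where
  "sgn_endo A = A /\<^sub>R norm A"

definition uniformity_endo :: "('a endo \<times> 'a endo) filter" where [code del]:
  "uniformity_endo = (INF e\<in>{0<..}. principal {(x, y). dist x y < e})"

definition open_endo :: "'a endo set \<Rightarrow> bool" where [code del]:
  "open_endo U \<longleftrightarrow> (\<forall>x\<in>U. \<forall>\<^sub>F (x', y) in uniformity. x' = x \<longrightarrow> y \<in> U)"

instance
proof
  fix A B :: "'a endo" and a :: real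
  show "norm A = 0 \<longleftrightarrow> A = 0" by transfer simp
  show "norm (A + B) \<le> norm A + norm B" by transfer (rule norm_triangle_ineq)
  show "norm (a *\<^sub>R A) = \<bar>a\<bar> * norm A" by transfer simp
qed (simp_all add: dist_endo_def sgn_endo_def uniformity_endo_def open_endo_def)

end

instantiation endo :: (euclidean_space) real_normed_algebra_1
begin

lift_definition one_endo :: "'a endo" is id_blinfun .
lift_definition times_endo :: "'a endo \<Rightarrow> 'a endo \<Rightarrow> 'a endo" is blinfun_compose .

instance
proof
  fix A B C :: "'a endo" and a b :: real
  show "A * B * C = A * (B * C)" by transfer (simp add: blinfun_eqI)
  show "(A + B) * C = A * C + B * C" by transfer (rule blinfun_eqI, simp add: blinfun.add_left)
  show "A * (B + C) = A * B + A * C" by transfer (rule blinfun_eqI, simp add: blinfun.add_left blinfun.add_right)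
  show "a *\<^sub>R A * B = a *\<^sub>R (A * B)" by transfer (rule blinfun_eqI, simp add: blinfun.scaleR_left)
  show "A * a *\<^sub>R B = a *\<^sub>R (A * B)" by transfer (rule blinfun_eqI, simp add: blinfun.scaleR_left blinfun.scaleR_right)
  show "1 * A = A" by transfer (simp add: blinfun_eqI)
  show "A * 1 = A" by transfer (simp add: blinfun_eqI)
  show "(0::'a endo) \<noteq> 1"
    by transfer (metis norm_blinfun_id norm_zero zero_neq_one)
  show "norm (A * B) \<le> norm A * norm B" by transfer (rule norm_blinfun_compose)
  show "norm (1::'a endo) = 1" by transfer simp
qed

end

instance endo :: (euclidean_space) banach
proof
  fix X :: "nat \<Rightarrow> 'a endo"
  assume "Cauchy X"
  then have "Cauchy (\<lambda>n. blinfun_of_endo (X n))"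
    by (simp add: Cauchy_def dist_norm norm_endo.rep_eq minus_endo.rep_eq)
  then obtain L where "(\<lambda>n. blinfun_of_endo (X n)) \<longlonglongrightarrow> L"
    by (meson Cauchy_convergent_iff convergent_def)
  then have "X \<longlonglongrightarrow> endo_of_blinfun L"
    by (simp add: lim_sequentially dist_norm norm_endo.rep_eq minus_endo.rep_eq endo_of_blinfun_inverse)
  then show "convergent X" by (rule convergentI)
qed

definition endo_apply :: "'a::euclidean_space endo \<Rightarrow> 'a \<Rightarrow> 'a"  (infixr "\<cdot>" 75)
  where "A \<cdot> v = blinfun_apply (blinfun_of_endo A) v"

lemma bounded_bilinear_endo_apply: "bounded_bilinear (\<cdot>)"
proof
  fix A B :: "'a endo" and v w :: 'a and r :: real
  show "(A + B) \<cdot> v = A \<cdot> v + B \<cdot> v"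
    by (simp add: endo_apply_def plus_endo.rep_eq blinfun.add_left)
  show "A \<cdot> (v + w) = A \<cdot> v + A \<cdot> w"
    by (simp add: endo_apply_def blinfun.add_right)
  show "(r *\<^sub>R A) \<cdot> v = r *\<^sub>R (A \<cdot> v)"
    by (simp add: endo_apply_def scaleR_endo.rep_eq blinfun.scaleR_left)
  show "A \<cdot> (r *\<^sub>R v) = r *\<^sub>R (A \<cdot> v)"
    by (simp add: endo_apply_def blinfun.scaleR_right)
  show "\<exists>K. \<forall>(A::'a endo) v. norm (A \<cdot> v) \<le> norm A * norm v * K"
    by (rule exI[of _ 1]) (simp add: endo_apply_def norm_endo.rep_eq norm_blinfun)
qed

interpretation endo: bounded_bilinear "(\<cdot>) :: 'a::euclidean_space endo \<Rightarrow> 'a \<Rightarrow> 'a"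
  by (rule bounded_bilinear_endo_apply)

lemma norm_endo_apply: "norm (A \<cdot> v) \<le> norm A * norm v"
  by (simp add: endo_apply_def norm_endo.rep_eq norm_blinfun)

lemma norm_endo_bound: "0 \<le> b \<Longrightarrow> (\<And>v. norm (A \<cdot> v) \<le> b * norm v) \<Longrightarrow> norm A \<le> b"
  by (simp add: endo_apply_def norm_endo.rep_eq norm_blinfun_bound)

lemma times_endo_apply [simp]: "(A * B) \<cdot> v = A \<cdot> B \<cdot> v"
  by (simp add: endo_apply_def times_endo.rep_eq)

lemma one_endo_apply [simp]: "1 \<cdot> v = v"
  by (simp add: endo_apply_def one_endo.rep_eq)

lemma endo_eqI: "(\<And>v. A \<cdot> v = B \<cdot> v) \<Longrightarrow> A = B"
  unfolding endo_apply_def by (metis blinfun_eqI blinfun_of_endo_inject)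

lemma endo_of_blinfun_apply: "bounded_linear g \<Longrightarrow> endo_of_blinfun (Blinfun g) \<cdot> v = g v"
  by (simp add: endo_apply_def endo_of_blinfun_inverse bounded_linear_Blinfun_apply)

section \<open>Adjoints and self-adjoint operators\<close>

definition adj :: "'a::euclidean_space endo \<Rightarrow> 'a endo" where
  "adj A = endo_of_blinfun (Blinfun (adjoint ((\<cdot>) A)))"

lemma adj_right: "x \<bullet> (adj A \<cdot> y) = (A \<cdot> x) \<bullet> y"
proof -
  have l: "linear ((\<cdot>) A)"
    using bounded_linear.linear endo.bounded_linear_right by blast
  have "bounded_linear (adjoint ((\<cdot>) A))"
    using adjoint_linear[OF l] linear_conv_bounded_linear by blast
  then show ?thesis
    using adjoint_works[OF l] by (simp add: adj_def endo_of_blinfun_apply)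
qed

lemma adj_left: "(adj A \<cdot> x) \<bullet> y = x \<bullet> (A \<cdot> y)"
  by (metis adj_right inner_commute)

lemma adj_eqI: "(\<And>x y. (A \<cdot> x) \<bullet> y = x \<bullet> (B \<cdot> y)) \<Longrightarrow> adj A = B"
  by (metis adj_right endo_eqI vector_eq_ldot)

lemma adj_adj [simp]: "adj (adj A) = A"
  by (rule adj_eqI) (simp add: adj_left)

lemma adj_mult: "adj (A * B) = adj B * adj A"
  by (rule adj_eqI) (simp add: adj_right)

definition selfadjoint :: "'a::euclidean_space endo \<Rightarrow> bool" where
  "selfadjoint A \<longleftrightarrow> adj A = A"

lemma selfadjoint_iff: "selfadjoint A \<longleftrightarrow> (\<forall>x y. (A \<cdot> x) \<bullet> y = x \<bullet> (A \<cdot> y))"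
  unfolding selfadjoint_def by (metis adj_eqI adj_left)

lemma selfadjointD: "selfadjoint A \<Longrightarrow> (A \<cdot> x) \<bullet> y = x \<bullet> (A \<cdot> y)"
  by (simp add: selfadjoint_iff)

lemma selfadjoint_0 [simp]: "selfadjoint 0"
  by (simp add: selfadjoint_iff endo.zero_left)

lemma selfadjoint_1 [simp]: "selfadjoint 1"
  by (simp add: selfadjoint_iff)

lemma selfadjoint_add: "selfadjoint A \<Longrightarrow> selfadjoint B \<Longrightarrow> selfadjoint (A + B)"
  by (simp add: selfadjoint_iff endo.add_left inner_add)

lemma selfadjoint_diff: "selfadjoint A \<Longrightarrow> selfadjoint B \<Longrightarrow> selfadjoint (A - B)"
  by (simp add: selfadjoint_iff endo.diff_left inner_diff)

lemma selfadjoint_scaleR: "selfadjoint A \<Longrightarrow> selfadjoint (r *\<^sub>R A)"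
  by (simp add: selfadjoint_iff endo.scaleR_left)

lemma selfadjoint_sum: "(\<And>i. i \<in> I \<Longrightarrow> selfadjoint (A i)) \<Longrightarrow> selfadjoint (\<Sum>i\<in>I. A i)"
  by (induction I rule: infinite_finite_induct) (simp_all add: selfadjoint_add)

lemma selfadjoint_power:
  assumes "selfadjoint A"
  shows "selfadjoint (A ^ n)"
proof (induction n)
  case (Suc n)
  then have "adj (A ^ Suc n) = A ^ n * A"
    using assms by (simp add: selfadjoint_def adj_mult)
  then show ?case
    by (simp add: selfadjoint_def power_commutes)
qed simp

lemma selfadjoint_exp:
  assumes "selfadjoint A"
  shows "selfadjoint (exp A)"
  unfolding selfadjoint_iff
proof (intro allI)
  fix x y
  have s: "(\<lambda>n. A ^ n /\<^sub>R fact n) sums exp A"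
    by (simp add: exp_converges)
  have "(\<lambda>n. ((A ^ n /\<^sub>R fact n) \<cdot> x) \<bullet> y) sums ((exp A \<cdot> x) \<bullet> y)"
    by (intro bounded_linear.sums[OF bounded_linear_inner_left]
        bounded_linear.sums[OF endo.bounded_linear_left] s)
  moreover have "(\<lambda>n. x \<bullet> ((A ^ n /\<^sub>R fact n) \<cdot> y)) sums (x \<bullet> (exp A \<cdot> y))"
    by (intro bounded_linear.sums[OF bounded_linear_inner_right]
        bounded_linear.sums[OF endo.bounded_linear_left] s)
  moreover have "((A ^ n /\<^sub>R fact n) \<cdot> x) \<bullet> y = x \<bullet> ((A ^ n /\<^sub>R fact n) \<cdot> y)" for n
    by (intro selfadjointD selfadjoint_scaleR selfadjoint_power assms)
  ultimately show "(exp A \<cdot> x) \<bullet> y = x \<bullet> (exp A \<cdot> y)"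
    by (simp add: sums_iff)
qed

section \<open>The trace\<close>

definition tr :: "'a::euclidean_space endo \<Rightarrow> real" where
  "tr A = (\<Sum>b\<in>Basis. b \<bullet> (A \<cdot> b))"

lemma bounded_linear_tr: "bounded_linear tr"
  unfolding tr_def
  by (intro bounded_linear_sum bounded_linear_compose[OF bounded_linear_inner_right]
      endo.bounded_linear_left)

lemmas tr_add = bounded_linear.linear[OF bounded_linear_tr, THEN linear_add]
lemmas tr_diff = bounded_linear.linear[OF bounded_linear_tr, THEN linear_diff]
lemmas tr_scaleR = bounded_linear.linear[OF bounded_linear_tr, THEN linear_scale]
lemmas tr_sum = bounded_linear.linear[OF bounded_linear_tr, THEN linear_sum]

lemma tr_1 [simp]: "tr (1::'a::euclidean_space endo) = DIM('a)"
  by (simp add: tr_def inner_same_Basis)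

lemma tr_mult_adj: "tr (A * B) = (\<Sum>b\<in>Basis. (adj A \<cdot> b) \<bullet> (B \<cdot> b))"
  by (simp add: tr_def adj_left)

lemma tr_mult_commute: "tr (A * B) = tr (B * A)"
proof -
  have *: "tr (A * B) = (\<Sum>b\<in>Basis. \<Sum>c\<in>Basis. (b \<bullet> (A \<cdot> c)) * (c \<bullet> (B \<cdot> b)))" for A B :: "'a endo"
  proof -
    have "(adj A \<cdot> b) \<bullet> (B \<cdot> b) = (\<Sum>c\<in>Basis. (b \<bullet> (A \<cdot> c)) * (c \<bullet> (B \<cdot> b)))" for b
      by (subst euclidean_inner) (intro sum.cong refl arg_cong2[of _ _ _ _ "(*)"] adj_left inner_commute)
    then show ?thesis
      unfolding tr_mult_adj by (simp only:)
  qed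
  show ?thesis
    unfolding * by (subst sum.swap) (simp add: mult.commute)
qed

lemma tr_adj: "tr (adj A) = tr A"
  by (simp add: tr_def adj_right inner_commute)

lemma tr_mult_adj_nonneg: "tr (A * adj A) \<ge> 0"
  by (simp add: tr_mult_adj sum_nonneg)

lemma tr_power_mult_commute: "tr ((A * B) ^ n) = tr ((B * A) ^ n)"
proof (cases n)
  case (Suc m)
  have "A * (B * A) ^ m = (A * B) ^ m * A" for m
  proof (induction m)
    case (Suc m)
    have "A * (B * A) ^ Suc m = (A * B) * (A * (B * A) ^ m)"
      by (simp add: mult.assoc)
    then show ?case
      by (simp only: Suc.IH power_Suc mult.assoc)
  qed simp
  note comm = this
  have "tr ((A * B) ^ Suc m) = tr (((A * B) ^ m * A) * B)"
    by (simp only: power_Suc2 mult.assoc)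
  also have "\<dots> = tr (B * ((A * B) ^ m * A))"
    by (rule tr_mult_commute)
  also have "\<dots> = tr ((B * A) ^ Suc m)"
    by (simp only: comm[symmetric] power_Suc mult.assoc)
  finally show ?thesis
    using Suc by simp
qed simp

section \<open>The Golden--Thompson inequality\<close>

text \<open>The squared Hilbert-Schmidt norm of S - T is nonnegative.\<close>

lemma tr_mult_le_selfadjoint:
  assumes "selfadjoint S" "selfadjoint T"
  shows "tr (S * T) \<le> (tr (S * S) + tr (T * T)) / 2"
proof -
  have "0 \<le> tr ((S - T) * adj (S - T))"
    by (rule tr_mult_adj_nonneg)
  also have "adj (S - T) = S - T"
    using selfadjoint_diff[OF assms] by (simp add: selfadjoint_def)
  also have "tr ((S - T) * (S - T)) = tr (S * S) + tr (T * T) - 2 * tr (S * T)"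
    by (simp add: algebra_simps tr_diff tr_add tr_mult_commute[of T S])
  finally show ?thesis by simp
qed

text \<open>Nonnegativity of the squared Hilbert-Schmidt norm of \<open>X - adj X\<close>;
  \<open>X * X\<close> and its adjoint have the same trace.\<close>

lemma tr_square_le: "tr (X * X) \<le> tr (X * adj X)"
proof -
  have a: "adj (X - adj X) = adj X - X"
    by (rule adj_eqI) (simp add: endo.diff_left inner_diff adj_left adj_right)
  have "0 \<le> tr ((X - adj X) * adj (X - adj X))"
    by (rule tr_mult_adj_nonneg)
  also have "\<dots> = 2 * tr (X * adj X) - tr (X * X) - tr (adj (X * X))"
    by (simp add: a algebra_simps tr_diff tr_add tr_mult_commute[of "adj X" X] adj_mult)
  finally show ?thesis by (simp add: tr_adj)
qed

text \<open>The two inequalities feed each other: the second one for \<open>m + 1\<close> follows from the second one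
  for \<open>m\<close> and \<open>X\<^sup>2\<close> and the first one for \<open>m\<close>, \<open>S = X X\<^sup>*\<close> and \<open>T = X\<^sup>* X\<close>; the first one for
  \<open>m + 1\<close> follows from the second one for \<open>m\<close> and \<open>X = S T\<close>.\<close>

lemma tr_power_product:
  fixes S T X :: "'a::euclidean_space endo"
  shows tr_power_mult_le: "selfadjoint S \<Longrightarrow> selfadjoint T \<Longrightarrow>
      tr ((S * T) ^ (2 ^ m)) \<le> tr (S ^ (2 ^ m) * T ^ (2 ^ m))" (is "_ \<Longrightarrow> _ \<Longrightarrow> ?P m S T")
    and tr_power_le: "tr (X ^ (2 ^ Suc m)) \<le> tr ((X * adj X) ^ (2 ^ m))" (is "?Q m X")
proof -
  have "(\<forall>S T. selfadjoint S \<longrightarrow> selfadjoint T \<longrightarrow> ?P m S T) \<and> (\<forall>X. ?Q m X)"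
  proof (induction m)
    case 0
    then show ?case
      by (simp add: tr_square_le power2_eq_square)
  next
    case (Suc m)
    have P: "?P m S T" if "selfadjoint S" "selfadjoint T" for S T
      using Suc that by blast
    have Q: "?Q m X" for X
      using Suc by blast
    have "?P (Suc m) S T" if S: "selfadjoint S" and T: "selfadjoint T" for S T
    proof -
      have "tr ((S * T) ^ (2 ^ Suc m)) \<le> tr ((S * T * adj (S * T)) ^ (2 ^ m))"
        by (rule Q)
      also have "S * T * adj (S * T) = (S * T * T) * S"
        using S T by (simp add: adj_mult selfadjoint_def mult.assoc)
      also have "tr (((S * T * T) * S) ^ (2 ^ m)) = tr ((S ^ 2 * T ^ 2) ^ (2 ^ m))"
        by (subst tr_power_mult_commute) (simp add: power2_eq_square mult.assoc)
      also have "\<dots> \<le> tr ((S ^ 2) ^ (2 ^ m) * (T ^ 2) ^ (2 ^ m))"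
        by (intro P selfadjoint_power S T)
      finally show ?thesis
        by (simp add: power_mult)
    qed
    moreover have "?Q (Suc m) X" for X
    proof -
      let ?S = "X * adj X" and ?T = "adj X * X"
      have sa: "selfadjoint ?S" "selfadjoint ?T"
        by (simp_all add: selfadjoint_def adj_mult)
      have "tr (X ^ (2 ^ Suc (Suc m))) = tr ((X ^ 2) ^ (2 ^ Suc m))"
        by (simp add: power_mult)
      also have "\<dots> \<le> tr ((X ^ 2 * adj (X ^ 2)) ^ (2 ^ m))"
        by (rule Q)
      also have "X ^ 2 * adj (X ^ 2) = X * (X * adj X * adj X)"
        by (simp add: power2_eq_square adj_mult mult.assoc)
      also have "tr ((X * (X * adj X * adj X)) ^ (2 ^ m)) = tr ((?S * ?T) ^ (2 ^ m))"
        by (subst tr_power_mult_commute) (simp add: mult.assoc)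
      also have "\<dots> \<le> tr (?S ^ (2 ^ m) * ?T ^ (2 ^ m))"
        by (rule P[OF sa])
      also have "\<dots> \<le> (tr (?S ^ (2 ^ Suc m)) + tr (?T ^ (2 ^ Suc m))) / 2"
        using tr_mult_le_selfadjoint[OF sa[THEN selfadjoint_power]]
        by (simp add: mult_2 power_add)
      also have "tr (?T ^ (2 ^ Suc m)) = tr (?S ^ (2 ^ Suc m))"
        by (rule tr_power_mult_commute)
      finally show ?thesis by simp
    qed
    ultimately show ?case by blast
  qed
  then show "selfadjoint S \<Longrightarrow> selfadjoint T \<Longrightarrow> ?P m S T" and "?Q m X"
    by blast+
qed

text \<open>Telescoping. Because of \<open>1 \<le> K\<close> the exponent n can stand in place of n
  - 1, which keeps the induction free of subtraction.\<close>

lemma norm_power_diff_le: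
  fixes X Y :: "'a::real_normed_algebra_1"
  assumes X: "norm X \<le> K" and Y: "norm Y \<le> K" and K: "1 \<le> K"
  shows "norm (X ^ n - Y ^ n) \<le> n * K ^ n * norm (X - Y)"
proof (induction n)
  case (Suc n)
  have K0: "0 \<le> K" using K by simp
  have "X ^ Suc n - Y ^ Suc n = X * (X ^ n - Y ^ n) + (X - Y) * Y ^ n"
    by (simp add: algebra_simps)
  also have "norm \<dots> \<le> K * (n * K ^ n * norm (X - Y)) + norm (X - Y) * K ^ n"
  proof (intro norm_triangle_mono)
    show "norm (X * (X ^ n - Y ^ n)) \<le> K * (n * K ^ n * norm (X - Y))"
      by (rule order_trans[OF norm_mult_ineq])
        (intro mult_mono X Suc.IH K0 norm_ge_zero)
    have "norm (Y ^ n) \<le> K ^ n"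
      by (rule order_trans[OF norm_power_ineq]) (intro power_mono Y norm_ge_zero)
    then show "norm ((X - Y) * Y ^ n) \<le> norm (X - Y) * K ^ n"
      by (rule order_trans[OF norm_mult_ineq mult_left_mono]) simp
  qed
  also have "norm (X - Y) * K ^ n \<le> norm (X - Y) * K ^ Suc n"
    using K by (intro mult_left_mono power_increasing) auto
  finally show ?case
    by (simp add: algebra_simps)
qed simp

lemma exp_scaleR_inverse_power:
  fixes A :: "'a::{real_normed_algebra_1,banach}"
  assumes "n > 0"
  shows "exp (A /\<^sub>R real n) ^ n = exp A"
proof -
  have "exp (real m *\<^sub>R X) = exp X ^ m" for m and X :: 'a
  proof (induction m)
    case (Suc m)
    have "exp (real (Suc m) *\<^sub>R X) = exp (X + real m *\<^sub>R X)"
      by (simp add: scaleR_add_left)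
    also have "\<dots> = exp X * exp (real m *\<^sub>R X)"
      by (rule exp_add_commuting) simp
    finally show ?case
      using Suc by simp
  qed simp
  from this[of n "A /\<^sub>R real n"] show ?thesis
    using assms by simp
qed

text \<open>\<open>G\<close> vanishes at 0 together with its derivative, so G(1/n) = o(1/n). Passing
  to n-th powers costs a factor n times a constant, and the error still tends to 0.\<close>

lemma lie_trotter:
  fixes A B :: "'a::{real_normed_algebra_1,banach}"
  shows "(\<lambda>n. (exp (A /\<^sub>R real n) * exp (B /\<^sub>R real n)) ^ n) \<longlonglongrightarrow> exp (A + B)"
proof -
  define G where "G s = exp (s *\<^sub>R A) * exp (s *\<^sub>R B) - exp (s *\<^sub>R (A + B))" for s :: real
  have "(G has_vector_derivative
      (exp (0 *\<^sub>R A) * (exp (0 *\<^sub>R B) * B) + (exp (0 *\<^sub>R A) * A) * exp (0 *\<^sub>R B))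
      - exp (0 *\<^sub>R (A + B)) * (A + B)) (at 0)"
    unfolding G_def
    by (intro has_vector_derivative_diff has_vector_derivative_mult
        exp_scaleR_has_vector_derivative_right)
  then have "(G has_vector_derivative 0) (at 0)"
    by simp
  moreover have "G 0 = 0" by (simp add: G_def)
  ultimately have "((\<lambda>s. norm (G s) / \<bar>s\<bar>) \<longlongrightarrow> 0) (at 0)"
    by (simp add: has_vector_derivative_def has_derivative_at)
  then have lim: "(\<lambda>n. norm (G (1 / real (Suc n))) / \<bar>1 / real (Suc n)\<bar>) \<longlonglongrightarrow> 0"
    by (rule filterlim_compose)
      (use LIMSEQ_Suc[OF lim_1_over_n] in \<open>auto simp: filterlim_at\<close>)
  let ?c = "exp (norm A + norm B)"
  have bound: "norm ((exp (A /\<^sub>R real n) * exp (B /\<^sub>R real n)) ^ n - exp (A + B))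
      \<le> ?c * (norm (G (1 / n)) / \<bar>1 / n\<bar>)" if n: "n > 0" for n :: nat
  proof -
    \<comment> \<open>Chosen so that \<open>K ^ n\<close> does not depend on n.\<close>
    define K where "K = exp ((norm A + norm B) / n)"
    have K: "1 \<le> K" by (simp add: K_def)
    have X: "norm (exp (A /\<^sub>R real n) * exp (B /\<^sub>R real n)) \<le> K"
    proof -
      have "norm (exp (A /\<^sub>R real n) * exp (B /\<^sub>R real n)) \<le> exp (norm (A /\<^sub>R real n)) * exp (norm (B /\<^sub>R real n))"
        by (rule order_trans[OF norm_mult_ineq]) (intro mult_mono norm_exp; simp)
      then show ?thesis
        by (simp add: K_def add_divide_distrib exp_add divide_inverse mult.commute distrib_left)
    qed
    have Y: "norm (exp ((A + B) /\<^sub>R real n)) \<le> K"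
    proof -
      have "norm ((A + B) /\<^sub>R real n) \<le> (norm A + norm B) / n"
        using n norm_triangle_ineq[of A B] by (simp add: divide_simps)
      then show ?thesis
        unfolding K_def by (meson exp_le_cancel_iff norm_exp order_trans)
    qed
    have "norm ((exp (A /\<^sub>R real n) * exp (B /\<^sub>R real n)) ^ n - exp ((A + B) /\<^sub>R real n) ^ n)
        \<le> n * K ^ n * norm (G (1 / n))"
      using norm_power_diff_le[OF X Y K, of n] by (simp add: G_def divide_inverse)
    moreover have "K ^ n = ?c"
      using n by (simp add: K_def flip: exp_of_nat_mult)
    moreover have "n * ?c * norm (G (1 / n)) = ?c * (norm (G (1 / n)) / \<bar>1 / n\<bar>)"
      using n by simp
    ultimately show ?thesis
      by (simp only: exp_scaleR_inverse_power[OF n])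
  qed
  have "(\<lambda>n. (exp (A /\<^sub>R real (Suc n)) * exp (B /\<^sub>R real (Suc n))) ^ Suc n - exp (A + B)) \<longlonglongrightarrow> 0"
  proof (rule Lim_null_comparison)
    show "\<forall>\<^sub>F n in sequentially. norm ((exp (A /\<^sub>R real (Suc n)) * exp (B /\<^sub>R real (Suc n))) ^ Suc n - exp (A + B))
        \<le> ?c * (norm (G (1 / real (Suc n))) / \<bar>1 / real (Suc n)\<bar>)"
      by (intro always_eventually allI bound) simp
    show "(\<lambda>n. ?c * (norm (G (1 / real (Suc n))) / \<bar>1 / real (Suc n)\<bar>)) \<longlonglongrightarrow> 0"
      by (rule tendsto_mult_right_zero[OF lim])
  qed
  then have "(\<lambda>n. (exp (A /\<^sub>R real (Suc n)) * exp (B /\<^sub>R real (Suc n))) ^ Suc n) \<longlonglongrightarrow> exp (A + B)"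
    by (simp only: LIM_zero_iff)
  then show ?thesis
    by (rule LIMSEQ_imp_Suc)
qed

theorem golden_thompson:
  assumes A: "selfadjoint A" and B: "selfadjoint B"
  shows "tr (exp (A + B)) \<le> tr (exp A * exp B)"
proof (rule LIMSEQ_le_const2)
  have "strict_mono (\<lambda>m::nat. 2 ^ m :: nat)"
    by (simp add: strict_mono_def)
  then have "(\<lambda>m. (exp (A /\<^sub>R real (2 ^ m)) * exp (B /\<^sub>R real (2 ^ m))) ^ (2 ^ m)) \<longlonglongrightarrow> exp (A + B)"
    using LIMSEQ_subseq_LIMSEQ[OF lie_trotter[of A B]] unfolding comp_def by blast
  then show "(\<lambda>m. tr ((exp (A /\<^sub>R real (2 ^ m)) * exp (B /\<^sub>R real (2 ^ m))) ^ (2 ^ m))) \<longlonglongrightarrow> tr (exp (A + B))"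
    by (rule bounded_linear.tendsto[OF bounded_linear_tr])
  have "tr ((exp (A /\<^sub>R real (2 ^ m)) * exp (B /\<^sub>R real (2 ^ m))) ^ (2 ^ m)) \<le> tr (exp A * exp B)" for m
    using tr_power_mult_le[of "exp (A /\<^sub>R real (2 ^ m))" "exp (B /\<^sub>R real (2 ^ m))" m]
      exp_scaleR_inverse_power[of "2 ^ m" A] exp_scaleR_inverse_power[of "2 ^ m" B]
    by (simp add: selfadjoint_exp selfadjoint_scaleR A B)
  then show "\<exists>N. \<forall>m\<ge>N. tr ((exp (A /\<^sub>R real (2 ^ m)) * exp (B /\<^sub>R real (2 ^ m))) ^ (2 ^ m)) \<le> tr (exp A * exp B)"
    by blast
qed

section \<open>Bounds for the trace exponential\<close>

lemma exp_half_mult_self: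
  fixes A :: "'a::{real_normed_algebra_1,banach}"
  shows "exp (A /\<^sub>R 2) * exp (A /\<^sub>R 2) = exp A"
  using exp_scaleR_inverse_power[of 2 A]
  by (simp only: power2_eq_square of_nat_numeral zero_less_numeral simp_thms)

text \<open>exp(A/2) is a self-adjoint square root of exp A, so the trace is a squared
  Hilbert-Schmidt norm. Positivity of exp A is obtained in this way, without a spectral
  decomposition.\<close>

lemma tr_exp_eq_sum:
  assumes "selfadjoint A"
  shows "tr (exp A) = (\<Sum>b\<in>Basis. (norm (exp (A /\<^sub>R 2) \<cdot> b))\<^sup>2)"
proof -
  have "selfadjoint (exp (A /\<^sub>R 2))"
    by (intro selfadjoint_exp selfadjoint_scaleR assms)
  then have "tr (exp (A /\<^sub>R 2) * exp (A /\<^sub>R 2)) = (\<Sum>b\<in>Basis. (norm (exp (A /\<^sub>R 2) \<cdot> b))\<^sup>2)"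
    unfolding tr_mult_adj selfadjoint_def power2_norm_eq_inner by (simp only:)
  then show ?thesis
    unfolding exp_half_mult_self .
qed

lemma tr_exp_nonneg: "selfadjoint A \<Longrightarrow> 0 \<le> tr (exp A)"
  by (simp add: tr_exp_eq_sum sum_nonneg)

text \<open>With W = exp(A/2), cyclicity turns tr(W W Z) into tr(W Z W), which is a sum of values of
  the quadratic form of Z at the vectors W b.\<close>

lemma tr_exp_mult_le:
  assumes A: "selfadjoint A" and Z: "\<And>v. v \<bullet> (Z \<cdot> v) \<le> c * (norm v)\<^sup>2"
  shows "tr (exp A * Z) \<le> c * tr (exp A)"
proof -
  let ?W = "exp (A /\<^sub>R 2)"
  have W: "selfadjoint ?W"
    by (intro selfadjoint_exp selfadjoint_scaleR A)
  have "tr (exp A * Z) = tr (?W * (?W * Z))"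
    unfolding mult.assoc[symmetric] exp_half_mult_self ..
  also have "\<dots> = tr (?W * (Z * ?W))"
    by (subst tr_mult_commute) (simp only: mult.assoc)
  also have "\<dots> = (\<Sum>b\<in>Basis. (?W \<cdot> b) \<bullet> (Z \<cdot> ?W \<cdot> b))"
    using W unfolding tr_mult_adj by (simp add: selfadjoint_def)
  also have "\<dots> \<le> (\<Sum>b\<in>Basis. c * (norm (?W \<cdot> b))\<^sup>2)"
    by (intro sum_mono Z)
  finally show ?thesis
    by (simp add: tr_exp_eq_sum[OF A] sum_distrib_left)
qed

lemma two_mult_three_power_le_fact: "2 * 3 ^ n \<le> (fact (n + 2) :: real)"
proof (induction n)
  case (Suc n)
  have "2 * 3 ^ Suc n = 3 * (2 * 3 ^ n :: real)" by simp
  also have "\<dots> \<le> real (n + 3) * fact (n + 2)"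
    using Suc by (intro mult_mono) auto
  finally show ?case by (simp add: algebra_simps)
qed simp

lemma norm_power_apply_le: "norm (A ^ n \<cdot> v) \<le> norm A ^ n * norm v"
  by (rule order_trans[OF norm_endo_apply]) (intro mult_right_mono norm_power_ineq norm_ge_zero)

text \<open>Bernstein's estimate: since \<open>n! \<ge> 2 * 3\<^bsup>n-2\<^esup>\<close>, the terms of order at least two of the
  exponential series are dominated by a geometric series.\<close>

lemma inner_exp_le:
  assumes D: "selfadjoint D" and R: "norm D \<le> R" and \<theta>: "0 \<le> \<theta>" "\<theta> * R < 3"
  shows "v \<bullet> (exp (\<theta> *\<^sub>R D) \<cdot> v)
    \<le> (norm v)\<^sup>2 + \<theta> * (v \<bullet> (D \<cdot> v)) + \<theta>\<^sup>2 / 2 / (1 - \<theta> * R / 3) * (norm (D \<cdot> v))\<^sup>2"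
proof -
  define a where "a n = v \<bullet> (((\<theta> *\<^sub>R D) ^ n /\<^sub>R fact n) \<cdot> v)" for n
  have "a sums (v \<bullet> (exp (\<theta> *\<^sub>R D) \<cdot> v))"
    unfolding a_def
    by (intro bounded_linear.sums[OF bounded_linear_inner_right]
        bounded_linear.sums[OF endo.bounded_linear_left] exp_converges)
  then have s1: "(\<lambda>n. a (n + 2)) sums (v \<bullet> (exp (\<theta> *\<^sub>R D) \<cdot> v) - (\<Sum>i<2. a i))"
    by (rule sums_split_initial_segment)
  have R0: "0 \<le> R" using R norm_ge_zero order_trans by blast
  define q where "q = \<theta> * R / 3"
  have q: "0 \<le> q" "q < 1" using R0 \<theta> by (auto simp: q_def)
  have s2: "(\<lambda>n. \<theta>\<^sup>2 / 2 * (norm (D \<cdot> v))\<^sup>2 * q ^ n) sums (\<theta>\<^sup>2 / 2 * (norm (D \<cdot> v))\<^sup>2 * (1 / (1 - q)))"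
    using q by (intro sums_mult geometric_sums) auto
  have "a (n + 2) \<le> \<theta>\<^sup>2 / 2 * (norm (D \<cdot> v))\<^sup>2 * q ^ n" for n
  proof -
    \<comment> \<open>One D is moved to the left and one stays on v, so that the bound contains |D
      v|^2 and not just |D|^2 |v|^2; the variance estimate is about |D v|^2.\<close>
    have "v \<bullet> (D ^ (n + 2) \<cdot> v) = (D \<cdot> v) \<bullet> (D ^ n \<cdot> D \<cdot> v)"
    proof -
      have "D ^ (n + 2) = D * D ^ n * D"
        by (simp add: power_commutes mult.assoc flip: power_Suc)
      then show ?thesis
        by (simp add: selfadjointD[OF D])
    qed
    also have "\<dots> \<le> norm (D \<cdot> v) * norm (D ^ n \<cdot> D \<cdot> v)"
      by (rule norm_cauchy_schwarz)
    also have "\<dots> \<le> norm (D \<cdot> v) * (R ^ n * norm (D \<cdot> v))"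
      by (intro mult_left_mono order_trans[OF norm_power_apply_le] mult_right_mono power_mono R) auto
    finally have "v \<bullet> (D ^ (n + 2) \<cdot> v) \<le> R ^ n * (norm (D \<cdot> v))\<^sup>2"
      by (simp add: power2_eq_square mult_ac)
    then have "\<theta> ^ (n + 2) * (v \<bullet> (D ^ (n + 2) \<cdot> v)) / fact (n + 2)
        \<le> \<theta> ^ (n + 2) * (R ^ n * (norm (D \<cdot> v))\<^sup>2) / fact (n + 2)"
      using \<theta> by (intro divide_right_mono mult_left_mono) auto
    also have "\<dots> \<le> \<theta> ^ (n + 2) * (R ^ n * (norm (D \<cdot> v))\<^sup>2) / (2 * 3 ^ n)"
      using \<theta> R0 two_mult_three_power_le_fact[of n] by (intro divide_left_mono) auto
    also have "\<dots> = \<theta>\<^sup>2 / 2 * (norm (D \<cdot> v))\<^sup>2 * q ^ n"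
      by (simp add: q_def power_add power_divide power_mult_distrib mult_ac power2_eq_square)
    finally show ?thesis
      by (simp only: a_def scaleR_power endo.scaleR_left inner_scaleR_right divide_inverse mult.commute)
  qed
  from sums_le[OF this s1 s2]
  have "v \<bullet> (exp (\<theta> *\<^sub>R D) \<cdot> v) \<le> (a 0 + a 1) + \<theta>\<^sup>2 / 2 * (norm (D \<cdot> v))\<^sup>2 * (1 / (1 - q))"
    by (simp add: numeral_2_eq_2)
  moreover have "a 0 = (norm v)\<^sup>2" "a 1 = \<theta> * (v \<bullet> (D \<cdot> v))"
    by (simp_all add: a_def endo.scaleR_left power2_norm_eq_inner)
  ultimately show ?thesis
    by (simp add: q_def)
qed

lemma exp_apply_eigenvector:
  assumes "A \<cdot> u = l *\<^sub>R u"
  shows "exp A \<cdot> u = exp l *\<^sub>R u"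
proof -
  have p: "A ^ n \<cdot> u = l ^ n *\<^sub>R u" for n
    by (induction n) (simp_all add: endo.scaleR_right assms)
  have "(\<lambda>n. (A ^ n /\<^sub>R fact n) \<cdot> u) sums (exp A \<cdot> u)"
    by (intro bounded_linear.sums[OF endo.bounded_linear_left] exp_converges)
  moreover have "(\<lambda>n. (l ^ n /\<^sub>R fact n) *\<^sub>R u) sums (exp l *\<^sub>R u)"
    by (intro bounded_linear.sums[OF bounded_linear_scaleR_left] exp_converges)
  ultimately show ?thesis
    by (simp add: endo.scaleR_left p sums_iff)
qed

lemma bessel_two:
  assumes "norm u = 1" "norm w = 1" "u \<bullet> w = 0"
  shows "(x \<bullet> u)\<^sup>2 + (x \<bullet> w)\<^sup>2 \<le> (norm x)\<^sup>2"
proof -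
  have uw: "u \<bullet> u = 1" "w \<bullet> w = 1" "w \<bullet> u = 0"
    using assms by (simp_all add: norm_eq_1 inner_commute)
  let ?y = "x - (x \<bullet> u) *\<^sub>R u - (x \<bullet> w) *\<^sub>R w"
  have "0 \<le> ?y \<bullet> ?y" by simp
  also have "?y \<bullet> ?y = x \<bullet> x - (x \<bullet> u)\<^sup>2 - (x \<bullet> w)\<^sup>2"
    by (simp add: inner_diff_left inner_diff_right uw assms(3) inner_commute[of u x] inner_commute[of w x]
        power2_eq_square)
  finally show ?thesis
    by (simp add: power2_norm_eq_inner)
qed

text \<open>W = exp(X/2) multiplies u and w by exp(l/2). Bessel's inequality for each W b, summed
  over the basis, needs only these two eigenvectors and no diagonalisation of X.\<close>

lemma tr_exp_ge_double_eigenvalue: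
  assumes X: "selfadjoint X" and uw: "norm u = 1" "norm w = 1" "u \<bullet> w = 0"
    and eig: "X \<cdot> u = l *\<^sub>R u" "X \<cdot> w = l *\<^sub>R w"
  shows "2 * exp l \<le> tr (exp X)"
proof -
  let ?W = "exp (X /\<^sub>R 2)"
  have W: "selfadjoint ?W"
    by (intro selfadjoint_exp selfadjoint_scaleR X)
  have nW: "(norm (?W \<cdot> z))\<^sup>2 = exp l" if "X \<cdot> z = l *\<^sub>R z" "norm z = 1" for z
  proof -
    have "?W \<cdot> z = exp (l / 2) *\<^sub>R z"
      by (rule exp_apply_eigenvector) (simp add: endo.scaleR_left that)
    then show ?thesis
      using that by (simp add: power2_eq_square flip: exp_add)
  qed
  \<comment> \<open>Since (W b) . z = b . (W z), this is Parseval's identity for W z.\<close>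
  have sq: "(\<Sum>b\<in>Basis. ((?W \<cdot> b) \<bullet> z)\<^sup>2) = (norm (?W \<cdot> z))\<^sup>2" for z
    unfolding power2_norm_eq_inner euclidean_inner[of "?W \<cdot> z" "?W \<cdot> z"]
    unfolding power2_eq_square selfadjointD[OF W, of z] inner_commute[of z] ..
  have "2 * exp l = (\<Sum>b\<in>Basis. ((?W \<cdot> b) \<bullet> u)\<^sup>2 + ((?W \<cdot> b) \<bullet> w)\<^sup>2)"
    by (simp only: sum.distrib sq nW uw eig mult_2)
  also have "\<dots> \<le> (\<Sum>b\<in>Basis. (norm (?W \<cdot> b))\<^sup>2)"
    by (intro sum_mono bessel_two uw)
  finally show ?thesis
    by (simp add: tr_exp_eq_sum[OF X])
qed

section \<open>Negatively correlated homogeneous measures\<close>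

text \<open>T is forced into the random set and U is kept out of it. Without normalisation the sums
  can be split and compared even where the conditioning event has mass zero.\<close>

definition wsum :: "('n::finite set \<Rightarrow> real) \<Rightarrow> 'n set \<Rightarrow> 'n set \<Rightarrow> ('n set \<Rightarrow> 'v::real_vector) \<Rightarrow> 'v" where
  "wsum \<mu> T U g = (\<Sum>S | T \<subseteq> S \<and> S \<inter> U = {}. \<mu> S *\<^sub>R g S)"

definition mass :: "('n::finite set \<Rightarrow> real) \<Rightarrow> 'n set \<Rightarrow> 'n set \<Rightarrow> real" where
  "mass \<mu> T U = (\<Sum>S | T \<subseteq> S \<and> S \<inter> U = {}. \<mu> S)"

lemma wsum_const: "wsum \<mu> T U (\<lambda>S. c) = mass \<mu> T U *\<^sub>R c"
  by (simp add: wsum_def mass_def scaleR_sum_left)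

lemma wsum_split:
  assumes "f \<notin> T" "f \<notin> U"
  shows "wsum \<mu> T U g = wsum \<mu> (insert f T) U g + wsum \<mu> T (insert f U) g"
proof -
  have "{S. T \<subseteq> S \<and> S \<inter> U = {}}
      = {S. insert f T \<subseteq> S \<and> S \<inter> U = {}} \<union> {S. T \<subseteq> S \<and> S \<inter> insert f U = {}}"
    using assms by auto
  then show ?thesis
    unfolding wsum_def by (simp add: sum.union_disjoint disjoint_iff)
qed

lemma mass_split:
  assumes "f \<notin> T" "f \<notin> U"
  shows "mass \<mu> T U = mass \<mu> (insert f T) U + mass \<mu> T (insert f U)"
  using wsum_split[OF assms, of \<mu> "\<lambda>_. 1::real"] by (simp add: wsum_const)

text \<open>The law of total expectation for the event f \<in> S, with denominators cleared. The
  index 1 stands for f \<in> S and 0 for its complement; a, p are the sum of g and the mass with e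
  forced in, b, q the same without e. The means \<alpha> = a1/p1 and \<beta> = a0/p0 satisfy \<beta>
  \<le> \<alpha>, and dropping e shifts weight towards the larger mean.\<close>

lemma conditional_mix_le:
  fixes a0 :: real
  assumes "0 < p1" "0 \<le> p0" "p1 \<le> q1" "p0 \<le> q0"
    and "a1 * q1 \<le> b1 * p1" "a0 * q0 \<le> b0 * p0" "p1 * q0 \<le> p0 * q1" "a0 * p1 \<le> a1 * p0"
    and "p0 = 0 \<Longrightarrow> a0 = 0" "q0 = 0 \<Longrightarrow> b0 = 0"
  shows "(a1 + a0) * (q1 + q0) \<le> (b1 + b0) * (p1 + p0)"
proof (cases "p0 = 0")
  case True
  with assms have "q0 = 0"
    by (simp add: mult_le_0_iff)
  with True assms show ?thesis by simp
next
  case False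
  with assms have p0: "0 < p0" by simp
  define \<alpha> \<beta> where "\<alpha> = a1 / p1" and "\<beta> = a0 / p0"
  have a: "a1 = \<alpha> * p1" "a0 = \<beta> * p0"
    using p0 assms by (simp_all add: \<alpha>_def \<beta>_def)
  have "\<alpha> * q1 \<le> b1" "\<beta> * q0 \<le> b0" "\<beta> \<le> \<alpha>"
    using assms p0 by (simp_all add: \<alpha>_def \<beta>_def field_simps)
  then have "(\<alpha> * q1 + \<beta> * q0) * (p1 + p0) \<le> (b1 + b0) * (p1 + p0)"
    using assms p0 by (intro mult_right_mono) auto
  moreover have "0 \<le> (\<alpha> - \<beta>) * (p0 * q1 - p1 * q0)"
    using \<open>\<beta> \<le> \<alpha>\<close> assms by simp
  ultimately show ?thesis
    by (simp add: a algebra_simps)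
qed

text \<open>Pairwise negative correlation is demanded after every conditioning, both on inclusion
  and on exclusion, because the induction in \<open>feder_mihail\<close> conditions on f in both
  ways.\<close>

locale homogeneous_neg_corr =
  fixes \<mu> :: "'n::finite set \<Rightarrow> real" and k :: nat
  assumes nonneg: "0 \<le> \<mu> S"
    and homog: "\<mu> S \<noteq> 0 \<Longrightarrow> card S = k"
    and neg_corr: "i \<noteq> j \<Longrightarrow> i \<notin> T \<union> U \<Longrightarrow> j \<notin> T \<union> U \<Longrightarrow>
      mass \<mu> (insert i (insert j T)) U * mass \<mu> T U
        \<le> mass \<mu> (insert i T) U * mass \<mu> (insert j T) U"
begin

lemma mass_nonneg: "0 \<le> mass \<mu> T U"
  by (simp add: mass_def sum_nonneg nonneg)

lemma mass_mono: "T \<subseteq> T' \<Longrightarrow> U \<subseteq> U' \<Longrightarrow> mass \<mu> T' U' \<le> mass \<mu> T U"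
  unfolding mass_def by (rule sum_mono2) (auto simp: nonneg)

lemma weight_le_mass: "T \<subseteq> S \<Longrightarrow> S \<inter> U = {} \<Longrightarrow> \<mu> S \<le> mass \<mu> T U"
  unfolding mass_def by (rule member_le_sum) (auto simp: nonneg)

lemma wsum_eq_0: "mass \<mu> T U = 0 \<Longrightarrow> wsum \<mu> T U g = 0"
  unfolding wsum_def
  by (rule sum.neutral) (metis (mono_tags) mem_Collect_eq nonneg order_antisym scaleR_eq_0_iff weight_le_mass)

lemma wsum_mono:
  fixes g h :: "'n set \<Rightarrow> real"
  assumes "\<And>S. T \<subseteq> S \<Longrightarrow> S \<inter> U = {} \<Longrightarrow> \<mu> S \<noteq> 0 \<Longrightarrow> g S \<le> h S"
  shows "wsum \<mu> T U g \<le> wsum \<mu> T U h"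
  unfolding wsum_def
proof (rule sum_mono)
  fix S assume "S \<in> {S. T \<subseteq> S \<and> S \<inter> U = {}}"
  then show "\<mu> S *\<^sub>R g S \<le> \<mu> S *\<^sub>R h S"
    using assms[of S] nonneg[of S] by (cases "\<mu> S = 0") (auto intro: mult_left_mono)
qed

text \<open>Double counting: a set S in the support is counted once for each element of S - T, that
  is, k - card T times.\<close>

lemma wsum_insert_sum:
  assumes "T \<inter> U = {}"
  shows "(\<Sum>f | f \<notin> T \<union> U. wsum \<mu> (insert f T) U g) = (real k - real (card T)) *\<^sub>R wsum \<mu> T U g"
proof -
  let ?A = "{S. T \<subseteq> S \<and> S \<inter> U = {}}"
  have "wsum \<mu> (insert f T) U g = (\<Sum>S\<in>?A. if f \<in> S then \<mu> S *\<^sub>R g S else 0)" for f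
    unfolding wsum_def by (subst sum.inter_filter[symmetric]) (auto intro!: sum.cong)
  then have "(\<Sum>f | f \<notin> T \<union> U. wsum \<mu> (insert f T) U g)
      = (\<Sum>S\<in>?A. \<Sum>f | f \<notin> T \<union> U. if f \<in> S then \<mu> S *\<^sub>R g S else 0)"
    by (simp only: sum.swap[of _ _ "{f. f \<notin> T \<union> U}"])
  also have "\<dots> = (\<Sum>S\<in>?A. (real k - real (card T)) *\<^sub>R (\<mu> S *\<^sub>R g S))"
  proof (rule sum.cong[OF refl])
    fix S assume S: "S \<in> ?A"
    have "(\<Sum>f | f \<notin> T \<union> U. if f \<in> S then \<mu> S *\<^sub>R g S else 0)
        = (\<Sum>f \<in> {f \<in> {f. f \<notin> T \<union> U}. f \<in> S}. \<mu> S *\<^sub>R g S)"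
      by (rule sum.inter_filter[symmetric]) simp
    also have "{f \<in> {f. f \<notin> T \<union> U}. f \<in> S} = S - T"
      using S by auto
    also have "(\<Sum>f\<in>S - T. \<mu> S *\<^sub>R g S) = real (card (S - T)) *\<^sub>R (\<mu> S *\<^sub>R g S)"
      by (simp add: sum_constant_scaleR)
    also have "real (card (S - T)) = real (card S) - real (card T)"
      using S by (simp add: card_Diff_subset card_mono of_nat_diff)
    also have "(real (card S) - real (card T)) *\<^sub>R (\<mu> S *\<^sub>R g S) = (real k - real (card T)) *\<^sub>R (\<mu> S *\<^sub>R g S)"
      using homog[of S] by (cases "\<mu> S = 0") auto
    finally show "(\<Sum>f | f \<notin> T \<union> U. if f \<in> S then \<mu> S *\<^sub>R g S else 0)
        = (real k - real (card T)) *\<^sub>R (\<mu> S *\<^sub>R g S)" .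
  qed
  finally show ?thesis
    by (simp add: wsum_def scaleR_sum_right)
qed

lemma mass_insert_sum:
  assumes "T \<inter> U = {}"
  shows "(\<Sum>f | f \<notin> T \<union> U. mass \<mu> (insert f T) U) = (real k - real (card T)) * mass \<mu> T U"
  using wsum_insert_sum[OF assms, of "\<lambda>_. 1::real"] by (simp add: wsum_const)

text \<open>The Feder--Mihail argument. By homogeneity the conditional covariances of \<open>g\<close> with the
  events \<open>f \<in> S\<close> given \<open>e \<in> S\<close> add up to zero, so one of them is nonnegative, and the claim
  follows by conditioning on the corresponding \<open>f\<close>.\<close>

lemma feder_mihail:
  fixes g :: "'n set \<Rightarrow> real"
  assumes mono: "\<And>S S'. S \<subseteq> S' \<Longrightarrow> g S \<le> g S'" and indep: "\<And>S. g (insert e S) = g S"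
    and "e \<notin> T \<union> U" "T \<inter> U = {}"
  shows "wsum \<mu> (insert e T) U g * mass \<mu> T U \<le> wsum \<mu> T U g * mass \<mu> (insert e T) U"
  using assms(3,4)
proof (induction "card (- (T \<union> U))" arbitrary: T U rule: less_induct)
  case less
  let ?Te = "insert e T"
  define F where "F = {f. f \<notin> ?Te \<union> U}"
  show ?case
  proof (cases "\<forall>f\<in>F. mass \<mu> (insert f ?Te) U = 0")
    \<comment> \<open>Given e, no further element can occur, so S is \<open>insert e T\<close>
      almost surely. There g has the value g T, its minimum over the supersets of T.\<close>
    case True
    have "wsum \<mu> ?Te U g = wsum \<mu> ?Te U (\<lambda>S. g T)"
      unfolding wsum_def
    proof (rule sum.cong[OF refl])
      fix S assume "S \<in> {S. ?Te \<subseteq> S \<and> S \<inter> U = {}}"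
      then have S: "?Te \<subseteq> S" "S \<inter> U = {}" by auto
      show "\<mu> S *\<^sub>R g S = \<mu> S *\<^sub>R g T"
      proof (cases "S = ?Te")
        case False
        then obtain f where f: "f \<in> S" "f \<notin> ?Te" using S by blast
        then have "f \<in> F" using S by (auto simp: F_def)
        then have "\<mu> S \<le> 0"
          using weight_le_mass[of "insert f ?Te" S U] f S True by simp
        then show ?thesis using nonneg[of S] by simp
      qed (simp add: indep)
    qed
    moreover have "wsum \<mu> T U (\<lambda>S. g T) \<le> wsum \<mu> T U g"
      by (rule wsum_mono) (rule mono)
    ultimately show ?thesis
      using mult_right_mono[OF _ mass_nonneg[of ?Te U], of "g T * mass \<mu> T U" "wsum \<mu> T U g"]
      by (simp add: wsum_const mult_ac)
  next
    case False
    define cov where "cov f = wsum \<mu> (insert f ?Te) U g * mass \<mu> ?Te U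
      - wsum \<mu> ?Te U g * mass \<mu> (insert f ?Te) U" for f
    have TeU: "?Te \<inter> U = {}" using less.prems by auto
    have "(\<Sum>f\<in>F. cov f) = 0"
      using wsum_insert_sum[OF TeU, of g] mass_insert_sum[OF TeU]
      by (simp add: cov_def sum_subtractf F_def flip: sum_distrib_left sum_distrib_right)
    \<comment> \<open>Terms of mass zero vanish, so an f with nonnegative covariance can be found
      among those of positive mass, as \<open>conditional_mix_le\<close> requires.\<close>
    moreover have "(\<Sum>f\<in>F. cov f) < 0"
      if *: "\<And>f. f \<in> F \<Longrightarrow> mass \<mu> (insert f ?Te) U \<noteq> 0 \<Longrightarrow> cov f < 0"
    proof -
      have "cov f \<le> 0" if "f \<in> F" for f
        using *[OF that] wsum_eq_0[of "insert f ?Te" U g] by (fastforce simp: cov_def)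
      moreover obtain f where "f \<in> F" "cov f < 0" using False * by blast
      ultimately have "(\<Sum>f\<in>F. cov f) < (\<Sum>f\<in>F. 0)"
        by (intro sum_strict_mono_ex1) auto
      then show ?thesis by simp
    qed
    ultimately obtain f where f: "f \<in> F" "mass \<mu> (insert f ?Te) U \<noteq> 0" "0 \<le> cov f"
      by (metis linorder_not_less order_less_irrefl)
    have fT: "f \<notin> T" "f \<notin> U" "f \<noteq> e" "f \<notin> ?Te" using f by (auto simp: F_def)
    have eT: "e \<notin> T" "e \<notin> U" using less.prems by auto
    have swap: "insert e (insert f T) = insert f ?Te" by auto
    have "card (- (insert f T \<union> U)) < card (- (T \<union> U))" "card (- (T \<union> insert f U)) < card (- (T \<union> U))"
      using fT by (auto intro!: psubset_card_mono)
    then have IH1: "wsum \<mu> (insert f ?Te) U g * mass \<mu> (insert f T) U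
          \<le> wsum \<mu> (insert f T) U g * mass \<mu> (insert f ?Te) U"
      and IH0: "wsum \<mu> ?Te (insert f U) g * mass \<mu> T (insert f U)
          \<le> wsum \<mu> T (insert f U) g * mass \<mu> ?Te (insert f U)"
      using less.hyps[of "insert f T" U] less.hyps[of T "insert f U"] less.prems fT swap by auto
    note split = wsum_split[OF fT(1,2)] wsum_split[OF fT(4,2)] mass_split[OF fT(1,2)] mass_split[OF fT(4,2)]
    show ?thesis
      unfolding split
    proof (rule conditional_mix_le)
      show "0 < mass \<mu> (insert f ?Te) U"
        using f mass_nonneg by (simp add: order_less_le)
      show "mass \<mu> (insert f ?Te) U * mass \<mu> T (insert f U) \<le> mass \<mu> ?Te (insert f U) * mass \<mu> (insert f T) U"
        using neg_corr[of f e T U] fT eT by (simp add: split algebra_simps)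
      show "wsum \<mu> ?Te (insert f U) g * mass \<mu> (insert f ?Te) U \<le> wsum \<mu> (insert f ?Te) U g * mass \<mu> ?Te (insert f U)"
        using f(3) by (simp add: cov_def split algebra_simps)
    qed (use IH1 IH0 in \<open>auto intro!: mass_nonneg mass_mono wsum_eq_0\<close>)
  qed
qed

section \<open>Conditional expectations and marginals\<close>

definition P :: "'n set \<Rightarrow> real" where "P T = mass \<mu> T {}"

text \<open>No random order appears. Every S \<supseteq> T in the support has k elements and hence
  reveals T first with the same probability, so revealing T is the same as conditioning on T
  \<subseteq> S. If \<open>P T = 0\<close>, the value is 0 by the convention for division; in
  \<open>E_step\<close> such values carry weight 0.\<close>

definition E :: "'n set \<Rightarrow> ('n set \<Rightarrow> 'v::real_vector) \<Rightarrow> 'v" where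
  "E T g = wsum \<mu> T {} g /\<^sub>R P T"

abbreviation marg :: "'n set \<Rightarrow> 'n \<Rightarrow> real" where
  "marg T l \<equiv> E T (\<lambda>S. if l \<in> S then 1 else 0)"

lemma P_nonneg: "0 \<le> P T"
  by (simp add: P_def mass_nonneg)

lemma P_anti: "T \<subseteq> T' \<Longrightarrow> P T' \<le> P T"
  by (simp add: P_def mass_mono)

lemma P_insert_neq_0D: "P (insert e T) \<noteq> 0 \<Longrightarrow> P T \<noteq> 0"
  using P_nonneg[of "insert e T"] P_anti[OF subset_insertI, of e T] by auto

lemma P_pos_card:
  assumes "P T \<noteq> 0"
  shows "card T \<le> k"
proof -
  obtain S where "T \<subseteq> S" "\<mu> S \<noteq> 0"
    using assms unfolding P_def mass_def by (force elim: sum.not_neutral_contains_not_neutral)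
  then show ?thesis
    using homog card_mono[of S T] by auto
qed

lemma E_linear:
  assumes "linear h"
  shows "h (E T g) = E T (\<lambda>S. h (g S))"
  by (simp add: E_def wsum_def linear_scale[OF assms] linear_sum[OF assms])

lemma E_add: "E T (\<lambda>S. g S + h S) = E T g + E T h"
  by (simp add: E_def wsum_def scaleR_add_right sum.distrib)

lemma E_diff: "E T (\<lambda>S. g S - h S) = E T g - E T h"
  by (simp add: E_def wsum_def scaleR_diff_right sum_subtractf)

lemma E_sum: "E T (\<lambda>S. \<Sum>i\<in>I. g i S) = (\<Sum>i\<in>I. E T (g i))"
  by (simp add: E_def wsum_def scaleR_sum_right sum.swap[of _ I])

lemma E_mult_left: "E T (\<lambda>S. c * g S) = c * E T g" for c :: real
  by (simp add: E_def wsum_def sum_distrib_left mult_ac)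

lemma E_const: "P T \<noteq> 0 \<Longrightarrow> E T (\<lambda>S. c) = c"
  by (simp add: E_def wsum_const P_def)

lemma E_cong:
  assumes "\<And>S. T \<subseteq> S \<Longrightarrow> \<mu> S \<noteq> 0 \<Longrightarrow> g S = h S"
  shows "E T g = E T h"
proof -
  have "\<mu> S *\<^sub>R g S = \<mu> S *\<^sub>R h S" if "T \<subseteq> S" for S
    using assms[OF that] by (cases "\<mu> S = 0") auto
  then have "wsum \<mu> T {} g = wsum \<mu> T {} h"
    unfolding wsum_def by (intro sum.cong refl) simp
  then show ?thesis
    by (simp add: E_def)
qed

lemma E_mono:
  fixes g h :: "'n set \<Rightarrow> real"
  assumes "\<And>S. T \<subseteq> S \<Longrightarrow> \<mu> S \<noteq> 0 \<Longrightarrow> g S \<le> h S"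
  shows "E T g \<le> E T h"
  using wsum_mono[of T "{}" g h] assms P_nonneg by (simp add: E_def mult_left_mono)

lemma wsum_indicator: "wsum \<mu> T {} (\<lambda>S. if l \<in> S then 1 else 0) = P (insert l T)"
  unfolding wsum_def P_def mass_def real_scaleR_def
  by (simp add: if_distrib[of "(*) _"] cong: if_cong)
    (subst sum.inter_filter[symmetric], auto intro!: sum.cong)

lemma marg_eq: "marg T l = P (insert l T) / P T"
  by (simp add: E_def wsum_indicator divide_inverse mult.commute)

lemma marg_nonneg: "0 \<le> marg T l"
  by (simp add: marg_eq P_nonneg)

lemma marg_mem: "l \<in> T \<Longrightarrow> P T \<noteq> 0 \<Longrightarrow> marg T l = 1"
  by (simp add: marg_eq insert_absorb)

lemma sum_marg:
  assumes "P T \<noteq> 0"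
  shows "(\<Sum>l\<in>UNIV. marg T l) = k"
proof -
  have "(\<Sum>l\<in>UNIV. marg T l) = E T (\<lambda>S. \<Sum>l\<in>UNIV. if l \<in> S then 1 else 0)"
    by (rule E_sum[symmetric])
  also have "\<dots> = E T (\<lambda>S. real k)"
    by (rule E_cong) (auto simp: sum.If_cases dest: homog)
  finally show ?thesis
    using assms by (simp add: E_const)
qed

lemma marg_insert_le:
  assumes "P (insert e T) \<noteq> 0" "l \<noteq> e" "l \<notin> T"
  shows "marg (insert e T) l \<le> marg T l"
proof (cases "e \<in> T")
  case True
  then show ?thesis by (simp add: insert_absorb)
next
  case False
  have "P (insert e T) > 0" "P T > 0"
    using assms P_nonneg P_insert_neq_0D by (simp_all add: order_less_le)
  then show ?thesis
    using neg_corr[of l e T "{}"] assms False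
    by (simp add: marg_eq P_def field_simps)
qed

text \<open>Makes the steps comparable: the variance at every stage is measured by the initial
  marginals, hence by the same \<pi>(f~).\<close>

lemma marg_le_marg_empty:
  assumes "P T \<noteq> 0" "l \<notin> T"
  shows "marg T l \<le> marg {} l"
proof -
  have "finite T" by simp
  then show ?thesis
    using assms
  proof (induction T)
    case (insert e T)
    then have "P T \<noteq> 0"
      by (blast dest: P_insert_neq_0D)
    with insert show ?case
      using marg_insert_le[of e T l] by fastforce
  qed simp
qed

text \<open>Revealing one more element: the next element is uniformly distributed on the part of
  \<open>S\<close> that has not been revealed yet.\<close>

definition step :: "'n set \<Rightarrow> 'n \<Rightarrow> real" where
  "step T j = P (insert j T) / ((real k - real (card T)) * P T)"

lemma step_nonneg: "0 \<le> step T j"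
proof (cases "P T = 0")
  case False
  then have "card T \<le> k" by (rule P_pos_card)
  then show ?thesis
    by (simp add: step_def P_nonneg)
qed (simp add: step_def)

lemma step_eq_marg: "step T j = marg T j / (real k - real (card T))"
  by (simp add: step_def marg_eq)

lemma E_step:
  assumes "P T \<noteq> 0" "card T < k"
  shows "E T g = (\<Sum>j\<in>- T. step T j *\<^sub>R E (insert j T) g)"
proof -
  have "wsum \<mu> (insert j T) {} g = P (insert j T) *\<^sub>R E (insert j T) g" for j
    using wsum_eq_0[of "insert j T" "{}" g] by (cases "P (insert j T) = 0") (auto simp: E_def P_def)
  then have "(\<Sum>j\<in>- T. step T j *\<^sub>R E (insert j T) g)
      = (\<Sum>j\<in>- T. inverse ((real k - real (card T)) * P T) *\<^sub>R wsum \<mu> (insert j T) {} g)"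
    by (simp add: step_def divide_inverse mult.commute)
  also have "\<dots> = inverse ((real k - real (card T)) * P T) *\<^sub>R
      ((real k - real (card T)) *\<^sub>R wsum \<mu> T {} g)"
    using wsum_insert_sum[of T "{}" g] by (simp add: scaleR_sum_right[symmetric] Compl_eq)
  finally show ?thesis
    using assms by (simp add: E_def)
qed

lemma step_sum: "P T \<noteq> 0 \<Longrightarrow> card T < k \<Longrightarrow> (\<Sum>j\<in>- T. step T j) = 1"
proof -
  assume *: "P T \<noteq> 0" "card T < k"
  have "1 = (\<Sum>j\<in>- T. step T j * E (insert j T) (\<lambda>_. 1))"
    using E_step[OF *, of "\<lambda>_. 1::real"] by (simp add: E_const *)
  also have "\<dots> = (\<Sum>j\<in>- T. step T j)"
    by (intro sum.cong refl) (metis E_const divide_eq_0_iff mult.right_neutral mult_zero_left step_def)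
  finally show ?thesis by simp
qed

text \<open>These are the weights q_l of the overview. At l = e the marginal rises to 1 instead of
  dropping; the added 1 turns this term into \<open>marg T e\<close>. By homogeneity both families
  of marginals add up to k, so the total is 1.\<close>

definition loss :: "'n set \<Rightarrow> 'n \<Rightarrow> 'n \<Rightarrow> real" where
  "loss T e l = marg T l - marg (insert e T) l + (if l = e then 1 else 0)"

lemma loss_nonneg:
  assumes "P (insert e T) \<noteq> 0"
  shows "0 \<le> loss T e l"
proof -
  have PT: "P T \<noteq> 0"
    using assms by (rule P_insert_neq_0D)
  consider "l = e" | "l \<noteq> e" "l \<in> T" | "l \<noteq> e" "l \<notin> T" by blast
  then show ?thesis
  proof cases
    case 1
    then show ?thesis
      using marg_mem[of e "insert e T"] assms marg_nonneg[of T e] by (simp add: loss_def)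
  next
    case 2
    then show ?thesis
      using marg_mem[of l "insert e T"] marg_mem[of l T] assms PT by (simp add: loss_def)
  next
    case 3
    then show ?thesis
      using marg_insert_le[OF assms] by (simp add: loss_def)
  qed
qed

lemma sum_loss:
  assumes "P (insert e T) \<noteq> 0"
  shows "(\<Sum>l\<in>UNIV. loss T e l) = 1"
proof -
  have PT: "P T \<noteq> 0"
    using assms by (rule P_insert_neq_0D)
  show ?thesis
    using sum_marg[OF PT] sum_marg[OF assms] by (simp add: loss_def sum.distrib sum_subtractf)
qed

lemma lipschitz_union:
  fixes g :: "'n set \<Rightarrow> real"
  assumes "\<And>S i. \<bar>g (insert i S) - g S\<bar> \<le> c i"
  shows "\<bar>g (S \<union> A) - g S\<bar> \<le> (\<Sum>i\<in>A. c i)"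
proof -
  have "finite A" by simp
  then show ?thesis
  proof (induction A)
    case (insert a A)
    then show ?case
      using assms[of a "S \<union> A"] by simp
  qed simp
qed

text \<open>Adding the linear function with coefficients \<open>c\<close> makes a Lipschitz function increasing,
  so that no coupling of the two conditional measures is needed.\<close>

lemma E_insert_diff_le:
  fixes g :: "'n set \<Rightarrow> real"
  assumes lip: "\<And>S i. \<bar>g (insert i S) - g S\<bar> \<le> c i" and e: "e \<notin> T" and PeT: "P (insert e T) \<noteq> 0"
  shows "E (insert e T) g - E T g \<le> c e + (\<Sum>l\<in>UNIV. loss T e l * c l)"
proof -
  have PT: "P T \<noteq> 0"
    using PeT by (rule P_insert_neq_0D)
  have c: "0 \<le> c i" for i
    using lip[of i "{}"] by linarith
  define ind where "ind l S = (if l \<in> S then 1 else 0 :: real)" for l :: 'n and S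
  \<comment> \<open>\<open>feder_mihail\<close> needs a function that ignores e. Deleting e costs c
    e when e is forced in, and c e times \<open>marg T e\<close> otherwise; the latter is exactly
    the term l = e of the sum over \<open>loss\<close>.\<close>
  define g0 where "g0 S = g (S - {e})" for S
  define G where "G S = g0 S + (\<Sum>l\<in>- {e}. c l * ind l S)" for S
  have lin: "(\<Sum>l\<in>- {e}. c l * ind l S) = (\<Sum>l\<in>S - {e}. c l)" for S
    unfolding ind_def by (rule sum.mono_neutral_cong_right) auto
  have "E (insert e T) G \<le> E T G"
  proof -
    have "G S \<le> G S'" if "S \<subseteq> S'" for S S'
    proof -
      have u: "S - {e} \<union> (S' - S - {e}) = S' - {e}" using that by auto
      have "g0 S - g0 S' \<le> (\<Sum>l\<in>S' - S - {e}. c l)"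
        using lipschitz_union[of g c "S - {e}" "S' - S - {e}", OF lip] u by (simp add: g0_def)
      moreover have "(\<Sum>l\<in>S' - {e}. c l) = (\<Sum>l\<in>S - {e}. c l) + (\<Sum>l\<in>S' - S - {e}. c l)"
        by (subst u[symmetric], rule sum.union_disjoint) auto
      ultimately show ?thesis by (simp add: G_def lin)
    qed
    moreover have "G (insert e S) = G S" for S
      by (simp add: G_def g0_def lin)
    ultimately have "wsum \<mu> (insert e T) {} G * P T \<le> wsum \<mu> T {} G * P (insert e T)"
      unfolding P_def using e by (intro feder_mihail) auto
    then show ?thesis
      using PT PeT P_nonneg[of T] P_nonneg[of "insert e T"] by (simp add: E_def field_simps)
  qed
  moreover have EG: "E X G = E X g0 + (\<Sum>l\<in>- {e}. c l * marg X l)" for X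
    by (simp add: G_def[abs_def] E_add E_sum E_mult_left ind_def)
  moreover have "E (insert e T) g \<le> E (insert e T) (\<lambda>S. g0 S + c e)"
  proof (rule E_mono)
    fix S assume "insert e T \<subseteq> S"
    then have "insert e (S - {e}) = S" by auto
    then show "g S \<le> g0 S + c e"
      using lip[of e "S - {e}"] by (simp add: g0_def)
  qed
  moreover have "E T (\<lambda>S. g0 S - c e * ind e S) \<le> E T g"
  proof (rule E_mono)
    fix S
    show "g0 S - c e * ind e S \<le> g S"
    proof (cases "e \<in> S")
      case True
      then have "insert e (S - {e}) = S" by auto
      then show ?thesis
        using lip[of e "S - {e}"] True by (simp add: g0_def ind_def)
    qed (simp add: g0_def ind_def)
  qed
  ultimately have "E (insert e T) g - E T g
      \<le> c e + c e * marg T e + (\<Sum>l\<in>- {e}. c l * marg T l) - (\<Sum>l\<in>- {e}. c l * marg (insert e T) l)"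
    by (simp add: E_add E_diff E_mult_left E_const PeT ind_def)
  also have "\<dots> = c e + (c e * marg T e + (\<Sum>l\<in>- {e}. loss T e l * c l))"
    by (simp add: loss_def algebra_simps sum_subtractf)
  also have "c e * marg T e = loss T e e * c e"
    using marg_mem[of e "insert e T"] PeT by (simp add: loss_def)
  also have "loss T e e * c e + (\<Sum>l\<in>- {e}. loss T e l * c l) = (\<Sum>l\<in>UNIV. loss T e l * c l)"
    by (simp add: sum.remove[of UNIV e] Compl_eq_Diff_UNIV)
  finally show ?thesis .
qed

text \<open>The marginals of l form a martingale, so their drops cancel on average and only the
  correction at j = l survives.\<close>

lemma step_loss_sum:
  assumes "P T \<noteq> 0" "card T < k" "l \<notin> T"
  shows "(\<Sum>j\<in>- T. step T j * loss T j l) = step T l"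
proof -
  have "(\<Sum>j\<in>- T. step T j * loss T j l) =
      (\<Sum>j\<in>- T. step T j) * marg T l - (\<Sum>j\<in>- T. step T j * marg (insert j T) l)
      + (\<Sum>j\<in>- T. if l = j then step T l else 0)"
    by (simp add: loss_def distrib_left right_diff_distrib sum.distrib sum_subtractf sum_distrib_right
        if_distrib[of "(*) _"] cong: if_cong)
  also have "(\<Sum>j\<in>- T. step T j * marg (insert j T) l) = marg T l"
    using E_step[OF assms(1,2), of "\<lambda>S. if l \<in> S then 1 else 0 :: real"] by simp
  finally show ?thesis
    using assms by (simp add: step_sum)
qed

end

section \<open>The martingale argument\<close>

lemma weighted_sum_square_le:
  fixes x q :: "'i \<Rightarrow> real"
  assumes "\<And>i. i \<in> I \<Longrightarrow> 0 \<le> q i" "(\<Sum>i\<in>I. q i) = 1"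
  shows "(\<Sum>i\<in>I. q i * x i)\<^sup>2 \<le> (\<Sum>i\<in>I. q i * (x i)\<^sup>2)"
proof -
  define m where "m = (\<Sum>i\<in>I. q i * x i)"
  have "0 \<le> (\<Sum>i\<in>I. q i * (x i - m)\<^sup>2)"
    by (intro sum_nonneg mult_nonneg_nonneg assms) auto
  also have "\<dots> = (\<Sum>i\<in>I. q i * (x i)\<^sup>2 - 2 * m * (q i * x i) + m\<^sup>2 * q i)"
    by (intro sum.cong refl) (simp add: power2_eq_square algebra_simps)
  also have "\<dots> = (\<Sum>i\<in>I. q i * (x i)\<^sup>2) - 2 * m * (\<Sum>i\<in>I. q i * x i) + m\<^sup>2 * (\<Sum>i\<in>I. q i)"
    by (simp only: sum.distrib sum_subtractf sum_distrib_left)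
  also have "\<dots> = (\<Sum>i\<in>I. q i * (x i)\<^sup>2) - m\<^sup>2"
    by (simp add: assms(2) m_def power2_eq_square)
  finally show ?thesis by (simp add: m_def)
qed

text \<open>\<open>lip\<close> is the hypothesis on the squares of the differences, read as a
  comparison of norms. The sum in \<open>variance_le\<close> is the quadratic form of \<pi>(f~), so
  V stands for its norm.\<close>

locale lipschitz_endo = homogeneous_neg_corr \<mu> k
  for \<mu> :: "'n::finite set \<Rightarrow> real" and k +
  fixes F :: "'n set \<Rightarrow> 'a::euclidean_space endo" and C :: "'n \<Rightarrow> 'a endo" and K V :: real
  assumes selfadj: "selfadjoint (F S)"
    and lip: "norm ((F (insert i S) - F S) \<cdot> v) \<le> norm (C i \<cdot> v)"
    and C_le: "norm (C i) \<le> K"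
    and V_nonneg: "0 \<le> V"
    and variance_le: "(\<Sum>l\<in>UNIV. marg {} l * (norm (C l \<cdot> v))\<^sup>2) \<le> V * (norm v)\<^sup>2"
begin

definition D :: "'n set \<Rightarrow> 'n \<Rightarrow> 'a endo" where
  "D T e = E (insert e T) F - E T F"

lemma K_nonneg: "0 \<le> K"
  using C_le norm_ge_zero order_trans by blast

lemma selfadjoint_E: "selfadjoint (E T F)"
  unfolding E_def wsum_def by (intro selfadjoint_scaleR selfadjoint_sum selfadj)

lemma selfadjoint_D: "selfadjoint (D T e)"
  unfolding D_def by (intro selfadjoint_diff selfadjoint_E)

lemma norm_D_apply_le:
  assumes "e \<notin> T" "P (insert e T) \<noteq> 0"
  shows "norm (D T e \<cdot> v) \<le> norm (C e \<cdot> v) + (\<Sum>l\<in>UNIV. loss T e l * norm (C l \<cdot> v))"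
proof -
  define u where "u = D T e \<cdot> v"
  define g where "g S = u \<bullet> (F S \<cdot> v)" for S
  have "linear (\<lambda>A. u \<bullet> (A \<cdot> v))"
    by (intro bounded_linear.linear bounded_linear_compose[OF bounded_linear_inner_right]
        endo.bounded_linear_left)
  from E_linear[OF this] have Eg: "E X g = u \<bullet> (E X F \<cdot> v)" for X
    by (simp add: g_def[abs_def])
  have "\<bar>g (insert i S) - g S\<bar> \<le> norm u * norm (C i \<cdot> v)" for i S
  proof -
    have "g (insert i S) - g S = u \<bullet> ((F (insert i S) - F S) \<cdot> v)"
      by (simp add: g_def endo.diff_left inner_diff)
    also have "\<bar>\<dots>\<bar> \<le> norm u * norm ((F (insert i S) - F S) \<cdot> v)"
      by (rule Cauchy_Schwarz_ineq2)
    also have "\<dots> \<le> norm u * norm (C i \<cdot> v)"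
      by (intro mult_left_mono lip norm_ge_zero)
    finally show ?thesis .
  qed
  from E_insert_diff_le[of g "\<lambda>i. norm u * norm (C i \<cdot> v)", OF this assms]
  have "norm u * norm u \<le> norm u * (norm (C e \<cdot> v) + (\<Sum>l\<in>UNIV. loss T e l * norm (C l \<cdot> v)))"
    by (simp add: Eg D_def u_def endo.diff_left distrib_left sum_distrib_left mult.left_commute
        flip: inner_diff_right power2_norm_eq_inner power2_eq_square)
  moreover have "0 \<le> norm (C e \<cdot> v) + (\<Sum>l\<in>UNIV. loss T e l * norm (C l \<cdot> v))"
    using assms by (intro add_nonneg_nonneg sum_nonneg mult_nonneg_nonneg loss_nonneg) auto
  ultimately have "norm u \<le> norm (C e \<cdot> v) + (\<Sum>l\<in>UNIV. loss T e l * norm (C l \<cdot> v))"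
    by (cases "norm u = 0") (simp_all add: mult_le_cancel_left)
  then show ?thesis by (simp add: u_def)
qed

lemma norm_D_le:
  assumes "e \<notin> T" "P (insert e T) \<noteq> 0"
  shows "norm (D T e) \<le> 2 * K"
proof (rule norm_endo_bound)
  fix v
  have Cv: "norm (C l \<cdot> v) \<le> K * norm v" for l
    by (rule order_trans[OF norm_endo_apply]) (intro mult_right_mono C_le norm_ge_zero)
  have "norm (D T e \<cdot> v) \<le> norm (C e \<cdot> v) + (\<Sum>l\<in>UNIV. loss T e l * norm (C l \<cdot> v))"
    by (rule norm_D_apply_le[OF assms])
  also have "\<dots> \<le> K * norm v + (\<Sum>l\<in>UNIV. loss T e l * (K * norm v))"
    by (intro add_mono sum_mono mult_left_mono Cv loss_nonneg assms)
  also have "\<dots> = 2 * K * norm v"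
    by (simp add: sum_loss assms flip: sum_distrib_right)
  finally show "norm (D T e \<cdot> v) \<le> 2 * K * norm v" .
qed (simp add: K_nonneg)

text \<open>(a + b)^2 \<le> 2 a^2 + 2 b^2, and convexity for the weights \<open>loss\<close>. After
  averaging over e the two terms have the same bound, whence the factor 4 in the variance.\<close>

lemma norm_D_apply_square_le:
  assumes "e \<notin> T" "P (insert e T) \<noteq> 0"
  shows "(norm (D T e \<cdot> v))\<^sup>2
    \<le> 2 * (norm (C e \<cdot> v))\<^sup>2 + 2 * (\<Sum>l\<in>UNIV. loss T e l * (norm (C l \<cdot> v))\<^sup>2)"
proof -
  let ?m = "\<Sum>l\<in>UNIV. loss T e l * norm (C l \<cdot> v)"
  have "(norm (D T e \<cdot> v))\<^sup>2 \<le> (norm (C e \<cdot> v) + ?m)\<^sup>2"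
    by (intro power_mono norm_D_apply_le assms) simp
  also have "\<dots> \<le> 2 * (norm (C e \<cdot> v))\<^sup>2 + 2 * ?m\<^sup>2"
    using sum_squares_ge_zero[of "norm (C e \<cdot> v) - ?m" 0] by (simp add: power2_eq_square algebra_simps)
  also have "?m\<^sup>2 \<le> (\<Sum>l\<in>UNIV. loss T e l * (norm (C l \<cdot> v))\<^sup>2)"
    by (intro weighted_sum_square_le loss_nonneg sum_loss assms)
  finally show ?thesis by simp
qed

lemma step_eq_0: "P (insert j T) = 0 \<Longrightarrow> step T j = 0"
  by (simp add: step_def)

lemma step_variance_le:
  assumes T: "P T \<noteq> 0" "card T < k"
  shows "(\<Sum>j\<in>- T. step T j * (norm (D T j \<cdot> v))\<^sup>2)
    \<le> 4 * V / (real k - real (card T)) * (norm v)\<^sup>2"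
proof -
  let ?c = "\<lambda>l. (norm (C l \<cdot> v))\<^sup>2"
  have "(\<Sum>j\<in>- T. step T j * (norm (D T j \<cdot> v))\<^sup>2)
      \<le> (\<Sum>j\<in>- T. step T j * (2 * ?c j + 2 * (\<Sum>l\<in>- T. loss T j l * ?c l)))"
  proof (rule sum_mono)
    fix j assume j: "j \<in> - T"
    show "step T j * (norm (D T j \<cdot> v))\<^sup>2 \<le> step T j * (2 * ?c j + 2 * (\<Sum>l\<in>- T. loss T j l * ?c l))"
    proof (cases "P (insert j T) = 0")
      case False
      \<comment> \<open>For l in T both marginals are 1. The sum is restricted to the complement of
        T because \<open>step_loss_sum\<close> holds there.\<close>
      have "loss T j l = 0" if "l \<in> T" for l
        using that j False T marg_mem[of l T] marg_mem[of l "insert j T"] by (auto simp: loss_def)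
      then have "(\<Sum>l\<in>UNIV. loss T j l * ?c l) = (\<Sum>l\<in>- T. loss T j l * ?c l)"
        by (intro sum.mono_neutral_right) auto
      then show ?thesis
        using norm_D_apply_square_le[of j T v] j False by (intro mult_left_mono step_nonneg) auto
    qed (simp add: step_eq_0)
  qed
  also have "\<dots> = 2 * (\<Sum>j\<in>- T. step T j * ?c j) + 2 * (\<Sum>j\<in>- T. \<Sum>l\<in>- T. step T j * loss T j l * ?c l)"
    by (simp add: sum.distrib sum_distrib_left distrib_left mult_ac)
  also have "(\<Sum>j\<in>- T. \<Sum>l\<in>- T. step T j * loss T j l * ?c l)
      = (\<Sum>l\<in>- T. (\<Sum>j\<in>- T. step T j * loss T j l) * ?c l)"
    by (subst sum.swap) (simp add: sum_distrib_right)
  also have "\<dots> = (\<Sum>l\<in>- T. step T l * ?c l)"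
    by (intro sum.cong refl) (simp add: step_loss_sum T)
  also have "2 * (\<Sum>j\<in>- T. step T j * ?c j) + 2 * (\<Sum>j\<in>- T. step T j * ?c j) = 4 * (\<Sum>l\<in>- T. step T l * ?c l)"
    by simp
  also have "\<dots> \<le> 4 * (\<Sum>l\<in>- T. marg {} l / (real k - real (card T)) * ?c l)"
    using T by (intro mult_left_mono sum_mono mult_right_mono)
      (auto simp: step_eq_marg intro!: divide_right_mono marg_le_marg_empty)
  also have "\<dots> \<le> 4 * (\<Sum>l\<in>UNIV. marg {} l / (real k - real (card T)) * ?c l)"
    using T by (intro mult_left_mono sum_mono2) (auto intro!: mult_nonneg_nonneg divide_nonneg_nonneg marg_nonneg)
  also have "\<dots> = 4 / (real k - real (card T)) * (\<Sum>l\<in>UNIV. marg {} l * ?c l)"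
    by (simp add: sum_distrib_left)
  also have "\<dots> \<le> 4 / (real k - real (card T)) * (V * (norm v)\<^sup>2)"
    using T by (intro mult_left_mono variance_le) auto
  finally show ?thesis by simp
qed

lemma step_D_sum:
  assumes T: "P T \<noteq> 0" "card T < k"
  shows "(\<Sum>j\<in>- T. step T j *\<^sub>R D T j) = 0"
proof -
  have "(\<Sum>j\<in>- T. step T j *\<^sub>R D T j)
      = (\<Sum>j\<in>- T. step T j *\<^sub>R E (insert j T) F) - (\<Sum>j\<in>- T. step T j) *\<^sub>R E T F"
    by (simp add: D_def scaleR_diff_right sum_subtractf scaleR_sum_left)
  then show ?thesis
    using step_sum[OF T] E_step[OF T, of F] by simp
qed

text \<open>Bernstein's estimate for each j, averaged: the linear term vanishes by the martingale
  property, the quadratic one is the variance, and 1 + x \<le> exp x makes the bounds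
  multiply.\<close>

lemma step_exp_le:
  assumes T: "P T \<noteq> 0" "card T < k"
    and \<theta>: "0 \<le> \<theta>" "\<theta> * (2 * K) < 3" and h: "h = \<theta>\<^sup>2 / 2 / (1 - \<theta> * (2 * K) / 3)"
  shows "v \<bullet> ((\<Sum>j\<in>- T. step T j *\<^sub>R exp (\<theta> *\<^sub>R D T j)) \<cdot> v)
    \<le> exp (4 * V * h / (real k - real (card T))) * (norm v)\<^sup>2"
proof -
  have h0: "0 \<le> h"
    unfolding h using \<theta> by (intro divide_nonneg_nonneg) auto
  have "v \<bullet> ((\<Sum>j\<in>- T. step T j *\<^sub>R exp (\<theta> *\<^sub>R D T j)) \<cdot> v)
      = (\<Sum>j\<in>- T. step T j * (v \<bullet> (exp (\<theta> *\<^sub>R D T j) \<cdot> v)))"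
    by (simp add: endo.sum_left endo.scaleR_left inner_sum_right)
  also have "\<dots> \<le> (\<Sum>j\<in>- T. step T j *
      ((norm v)\<^sup>2 + \<theta> * (v \<bullet> (D T j \<cdot> v)) + h * (norm (D T j \<cdot> v))\<^sup>2))"
  proof (rule sum_mono)
    fix j assume "j \<in> - T"
    then show "step T j * (v \<bullet> (exp (\<theta> *\<^sub>R D T j) \<cdot> v))
        \<le> step T j * ((norm v)\<^sup>2 + \<theta> * (v \<bullet> (D T j \<cdot> v)) + h * (norm (D T j \<cdot> v))\<^sup>2)"
      using inner_exp_le[OF selfadjoint_D norm_D_le \<theta>, of j T v] step_nonneg[of T j]
      by (cases "P (insert j T) = 0") (auto simp: step_eq_0 h intro: mult_left_mono)
  qed
  also have "\<dots> = (\<Sum>j\<in>- T. step T j) * (norm v)\<^sup>2 + \<theta> * (\<Sum>j\<in>- T. step T j * (v \<bullet> (D T j \<cdot> v)))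
      + h * (\<Sum>j\<in>- T. step T j * (norm (D T j \<cdot> v))\<^sup>2)"
    by (simp add: sum.distrib distrib_left sum_distrib_left sum_distrib_right mult_ac)
  also have "(\<Sum>j\<in>- T. step T j * (v \<bullet> (D T j \<cdot> v))) = v \<bullet> ((\<Sum>j\<in>- T. step T j *\<^sub>R D T j) \<cdot> v)"
    by (simp add: endo.sum_left endo.scaleR_left inner_sum_right)
  also have "\<dots> = 0"
    by (simp add: step_D_sum T endo.zero_left)
  also have "h * (\<Sum>j\<in>- T. step T j * (norm (D T j \<cdot> v))\<^sup>2)
      \<le> h * (4 * V / (real k - real (card T)) * (norm v)\<^sup>2)"
    by (intro mult_left_mono step_variance_le T h0)
  finally have "v \<bullet> ((\<Sum>j\<in>- T. step T j *\<^sub>R exp (\<theta> *\<^sub>R D T j)) \<cdot> v)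
      \<le> (1 + 4 * V * h / (real k - real (card T))) * (norm v)\<^sup>2"
    by (simp add: step_sum T algebra_simps)
  also have "\<dots> \<le> exp (4 * V * h / (real k - real (card T))) * (norm v)\<^sup>2"
    by (intro mult_right_mono exp_ge_add_one_self) simp
  finally show ?thesis .
qed

text \<open>The free A lets the induction close: \<theta> D is absorbed into A for the inductive
  hypothesis and then split off by Golden-Thompson. Its averaged exponential costs a scalar with
  exponent 4 V h / (k - card T), and these exponents add up to the harmonic number.\<close>

theorem conditional_tr_exp_le:
  assumes \<theta>: "0 \<le> \<theta>" "\<theta> * (2 * K) < 3" and h: "h = \<theta>\<^sup>2 / 2 / (1 - \<theta> * (2 * K) / 3)"
    and "P T \<noteq> 0" "selfadjoint A"
  shows "E T (\<lambda>S. tr (exp (A + \<theta> *\<^sub>R (F S - E T F)))) \<le> exp (4 * V * h * harm (k - card T)) * tr (exp A)"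
  using assms(4,5)
proof (induction "k - card T" arbitrary: T A)
  case 0
  \<comment> \<open>Everything has been revealed: S = T almost surely, and no deviation from the
    mean is left.\<close>
  then have cT: "card T = k"
    using P_pos_card[of T] by simp
  have S: "S = T" if "T \<subseteq> S" "\<mu> S \<noteq> 0" for S
    using card_subset_eq[of S T] that homog[of S] cT by simp
  have "E T F = E T (\<lambda>S. F T)"
    by (rule E_cong) (use S in blast)
  then have ETF: "E T F = F T"
    using 0 by (simp add: E_const)
  have "E T (\<lambda>S. tr (exp (A + \<theta> *\<^sub>R (F S - E T F)))) = E T (\<lambda>S. tr (exp A))"
    by (rule E_cong) (drule (1) S, simp add: ETF)
  then show ?case
    using 0 cT by (simp add: E_const harm_def)
next
  case (Suc n)
  have T: "P T \<noteq> 0" "card T < k" using Suc by auto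
  have r: "real k - real (card T) = Suc n"
    using Suc.hyps(2) T by linarith
  define Z where "Z = (\<Sum>j\<in>- T. step T j *\<^sub>R exp (\<theta> *\<^sub>R D T j))"
  let ?\<Phi> = "\<lambda>S. tr (exp (A + \<theta> *\<^sub>R (F S - E T F)))"
  have "E T ?\<Phi> = (\<Sum>j\<in>- T. step T j * E (insert j T) ?\<Phi>)"
    using E_step[OF T, of ?\<Phi>] by simp
  also have "\<dots> \<le> (\<Sum>j\<in>- T. step T j * (exp (4 * V * h * harm n) * tr (exp A * exp (\<theta> *\<^sub>R D T j))))"
  proof (rule sum_mono)
    fix j assume j: "j \<in> - T"
    show "step T j * E (insert j T) ?\<Phi>
        \<le> step T j * (exp (4 * V * h * harm n) * tr (exp A * exp (\<theta> *\<^sub>R D T j)))"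
    proof (cases "P (insert j T) = 0")
      case False
      have n: "n = k - card (insert j T)"
        using Suc.hyps(2) j by simp
      have sD: "selfadjoint (\<theta> *\<^sub>R D T j)"
        by (intro selfadjoint_scaleR selfadjoint_D)
      have "?\<Phi> = (\<lambda>S. tr (exp ((A + \<theta> *\<^sub>R D T j) + \<theta> *\<^sub>R (F S - E (insert j T) F))))"
        by (simp add: D_def algebra_simps)
      then have "E (insert j T) ?\<Phi> \<le> exp (4 * V * h * harm n) * tr (exp (A + \<theta> *\<^sub>R D T j))"
        using Suc.hyps(1)[OF n False selfadjoint_add[OF Suc.prems(2) sD]] n by simp
      also have "\<dots> \<le> exp (4 * V * h * harm n) * tr (exp A * exp (\<theta> *\<^sub>R D T j))"
        by (intro mult_left_mono golden_thompson Suc.prems sD) simp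
      finally show ?thesis
        by (intro mult_left_mono step_nonneg)
    qed (simp add: step_eq_0)
  qed
  also have "\<dots> = exp (4 * V * h * harm n) * tr (exp A * Z)"
    by (simp add: Z_def sum_distrib_left tr_sum tr_scaleR mult_ac)
  also have "\<dots> \<le> exp (4 * V * h * harm n) * (exp (4 * V * h / Suc n) * tr (exp A))"
    using step_exp_le[OF T \<theta> h] unfolding Z_def r
    by (intro mult_left_mono tr_exp_mult_le Suc.prems) auto
  also have "\<dots> = exp (4 * V * h * harm (k - card T)) * tr (exp A)"
    unfolding Suc.hyps(2)[symmetric] harm_Suc by (simp add: distrib_left exp_add divide_inverse)
  finally show ?case .
qed

end

section \<open>Strong Rayleigh measures\<close>

lemma bij_Collect_mem: "bij (\<lambda>S i. i \<in> S)"
proof (rule bijI')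
  show "(\<lambda>i. i \<in> S) = (\<lambda>i. i \<in> S') \<longleftrightarrow> S = S'" for S S' :: "'a set"
    by (auto dest: fun_cong)
  show "\<exists>S. x = (\<lambda>i. i \<in> S)" for x :: "'a \<Rightarrow> bool"
    by (rule exI[of _ "Collect x"]) simp
qed

lemma sum_cube_eq_sum_sets:
  "(\<Sum>x\<in>UNIV. h x) = (\<Sum>S\<in>UNIV. h (\<lambda>i. i \<in> S))" for h :: "('n::finite \<Rightarrow> bool) \<Rightarrow> 'b::comm_monoid_add"
  by (rule sum.reindex_bij_betw[OF bij_Collect_mem, symmetric])

lemma gen_poly_eq_sum_sets:
  "gen_poly \<pi> z = (\<Sum>S\<in>UNIV. of_real (\<pi> (\<lambda>i. i \<in> S)) * (\<Prod>i\<in>UNIV. if i \<in> S then z i else 1))"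
  unfolding gen_poly_def sum_cube_eq_sum_sets
  by (intro sum.cong refl arg_cong2[of _ _ _ _ "(*)"] prod.cong) auto

text \<open>Coordinates in \<open>T\<close> are sent to infinity, coordinates in \<open>U\<close> to zero and all others
  except \<open>i\<close> and \<open>j\<close> to one, within the upper half-plane; the rescaled generating polynomial
  converges to a bilinear polynomial in the coordinates \<open>i\<close> and \<open>j\<close> with real coefficients.\<close>

definition scaled_factor :: "'n set \<Rightarrow> 'n set \<Rightarrow> 'n \<Rightarrow> 'n \<Rightarrow> 'n set \<Rightarrow> real \<Rightarrow> 'n \<Rightarrow> complex" where
  "scaled_factor T U i j S \<epsilon> l =
    (if l \<in> T then (if l \<in> S then 1 else - (\<i> * of_real \<epsilon>))
     else if l \<in> U then (if l \<in> S then \<i> * of_real \<epsilon> else 1)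
     else if l = i \<or> l = j then 1
     else if l \<in> S then 1 + \<i> * of_real \<epsilon> else 1)"

definition scaled_coeff :: "('n::finite set \<Rightarrow> real) \<Rightarrow> 'n set \<Rightarrow> 'n set \<Rightarrow> 'n \<Rightarrow> 'n \<Rightarrow> bool \<Rightarrow> bool \<Rightarrow> real \<Rightarrow> complex" where
  "scaled_coeff \<mu> T U i j a b \<epsilon> =
    (\<Sum>S | (i \<in> S) = a \<and> (j \<in> S) = b. of_real (\<mu> S) * (\<Prod>l\<in>UNIV. scaled_factor T U i j S \<epsilon> l))"

lemma scaled_coeff_tendsto:
  "(scaled_coeff \<mu> T U i j a b \<longlongrightarrow> scaled_coeff \<mu> T U i j a b 0) (at_right 0)"
proof -
  have "((\<lambda>\<epsilon>. scaled_factor T U i j S \<epsilon> l) \<longlongrightarrow> scaled_factor T U i j S 0 l) (at_right 0)" for S l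
    unfolding scaled_factor_def by (auto intro!: tendsto_eq_intros)
  then show ?thesis
    unfolding scaled_coeff_def by (intro tendsto_sum tendsto_mult tendsto_prod tendsto_const)
qed

lemma scaled_coeff_0:
  assumes "T \<inter> U = {}" "i \<notin> T \<union> U" "j \<notin> T \<union> U"
  shows "scaled_coeff \<mu> T U i j a b 0
    = of_real (\<Sum>S | T \<subseteq> S \<and> S \<inter> U = {} \<and> (i \<in> S) = a \<and> (j \<in> S) = b. \<mu> S)"
proof -
  have "(\<Prod>l\<in>UNIV. scaled_factor T U i j S 0 l) = (if T \<subseteq> S \<and> S \<inter> U = {} then 1 else 0)" for S
  proof (cases "T \<subseteq> S \<and> S \<inter> U = {}")
    case True
    then have "scaled_factor T U i j S 0 l = 1" for l
      by (auto simp: scaled_factor_def)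
    then show ?thesis using True by simp
  next
    case False
    then obtain l where "l \<in> T \<and> l \<notin> S \<or> l \<in> S \<and> l \<in> U" by blast
    then have "scaled_factor T U i j S 0 l = 0"
      using assms by (auto simp: scaled_factor_def)
    then show ?thesis
      using False by (auto intro!: prod_zero)
  qed
  then have "scaled_coeff \<mu> T U i j a b 0
      = (\<Sum>S | (i \<in> S) = a \<and> (j \<in> S) = b. if T \<subseteq> S \<and> S \<inter> U = {} then of_real (\<mu> S) else 0)"
    by (simp add: scaled_coeff_def if_distrib[of "(*) _"] cong: if_cong)
  also have "\<dots> = (\<Sum>S | T \<subseteq> S \<and> S \<inter> U = {} \<and> (i \<in> S) = a \<and> (j \<in> S) = b. of_real (\<mu> S))"
    by (subst sum.inter_filter[symmetric]) (auto intro!: sum.cong)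
  finally show ?thesis by simp
qed

lemma gen_poly_scaled:
  fixes T U :: "'n::finite set" and \<pi> :: "('n \<Rightarrow> bool) \<Rightarrow> real"
  assumes "i \<noteq> j" "T \<inter> U = {}" "i \<notin> T \<union> U" "j \<notin> T \<union> U" "\<epsilon> \<noteq> 0"
    and z: "z = (\<lambda>l. if l \<in> T then \<i> / of_real \<epsilon> else if l \<in> U then \<i> * of_real \<epsilon>
        else if l = i then u else if l = j then w else 1 + \<i> * of_real \<epsilon>)"
  defines "c \<equiv> scaled_coeff (\<lambda>S. \<pi> (\<lambda>i. i \<in> S)) T U i j"
  shows "gen_poly \<pi> z = (\<i> / of_real \<epsilon>) ^ card T *
    (c False False \<epsilon> + c True False \<epsilon> * u + c False True \<epsilon> * w + c True True \<epsilon> * u * w)"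
proof -
  let ?\<mu> = "\<lambda>S. complex_of_real (\<pi> (\<lambda>i. i \<in> S))"
  let ?w = "\<lambda>S. \<Prod>l\<in>UNIV. scaled_factor T U i j S \<epsilon> l"
  let ?m = "\<lambda>S. (if i \<in> S then u else 1) * (if j \<in> S then w else 1)"
  have "(\<Prod>l\<in>UNIV. if l \<in> S then z l else 1) = (\<i> / of_real \<epsilon>) ^ card T * ?w S * ?m S" for S
  proof -
    \<comment> \<open>The power of \<i>/\<epsilon> is extracted for all of T; for l in T but not in
      S the factor -\<i>\<epsilon> compensates for it.\<close>
    have "(if l \<in> S then z l else 1) = (if l \<in> T then \<i> / of_real \<epsilon> else 1) * scaled_factor T U i j S \<epsilon> l
        * ((if l = i then (if i \<in> S then u else 1) else 1) * (if l = j then (if j \<in> S then w else 1) else 1))" for l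
      using assms(1-5) by (auto simp: z scaled_factor_def)
    then have "(\<Prod>l\<in>UNIV. if l \<in> S then z l else 1) =
        (\<Prod>l\<in>UNIV. if l \<in> T then \<i> / of_real \<epsilon> else 1) * ?w S * ?m S"
      by (simp add: prod.distrib prod.delta)
    also have "(\<Prod>l\<in>UNIV. if l \<in> T then \<i> / of_real \<epsilon> else 1) = (\<i> / complex_of_real \<epsilon>) ^ card T"
      by (simp add: prod.If_cases)
    finally show ?thesis .
  qed
  then have "gen_poly \<pi> z = (\<i> / of_real \<epsilon>) ^ card T * (\<Sum>S\<in>UNIV. ?\<mu> S * ?w S * ?m S)"
    by (simp add: gen_poly_eq_sum_sets sum_distrib_left mult_ac)
  also have "(\<Sum>S\<in>UNIV. ?\<mu> S * ?w S * ?m S) = (\<Sum>(a, b)\<in>UNIV. \<Sum>S | (i \<in> S) = a \<and> (j \<in> S) = b. ?\<mu> S * ?w S * ?m S)"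
    using sum.group[of UNIV UNIV "\<lambda>S. (i \<in> S, j \<in> S)" "\<lambda>S. ?\<mu> S * ?w S * ?m S"]
    by (simp add: case_prod_unfold prod_eq_iff)
  also have "\<dots> = (\<Sum>(a, b)\<in>UNIV. c a b \<epsilon> * (if a then u else 1) * (if b then w else 1))"
    unfolding c_def scaled_coeff_def
    by (intro sum.cong refl) (auto simp: sum_distrib_right mult.assoc intro!: sum.cong)
  also have "\<dots> = c False False \<epsilon> + c True False \<epsilon> * u + c False True \<epsilon> * w + c True True \<epsilon> * u * w"
    by (simp add: UNIV_Times_UNIV[symmetric] UNIV_bool sum.cartesian_product[symmetric] del: UNIV_Times_UNIV)
  finally show ?thesis .
qed

lemma Im_moebius:
  "Im (- (of_real a + of_real c * \<i>) / (of_real b + of_real d * \<i>)) = (a * d - b * c) / (b\<^sup>2 + d\<^sup>2)"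
  by (simp add: Im_divide power2_eq_square algebra_simps)

text \<open>If \<open>a d > b c\<close>, the Moebius transformation that solves \<open>a + b u + c w + d u w = 0\<close> for \<open>u\<close>
  maps the upper half-plane to itself.\<close>

lemma strong_rayleigh_bilinear:
  fixes \<pi> :: "('n::finite \<Rightarrow> bool) \<Rightarrow> real"
  assumes sr: "strong_rayleigh \<pi>" and ij: "i \<noteq> j" and T: "T \<inter> U = {}" "i \<notin> T \<union> U" "j \<notin> T \<union> U"
  defines "m \<equiv> \<lambda>a b. \<Sum>S | T \<subseteq> S \<and> S \<inter> U = {} \<and> (i \<in> S) = a \<and> (j \<in> S) = b. \<pi> (\<lambda>i. i \<in> S)"
  shows "m False False * m True True \<le> m True False * m False True"
proof (rule ccontr)
  assume "\<not> ?thesis"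
  then have neg: "m True False * m False True < m False False * m True True" by simp
  define c where "c = scaled_coeff (\<lambda>S. \<pi> (\<lambda>i. i \<in> S)) T U i j"
  have lim: "(c a b \<longlongrightarrow> of_real (m a b)) (at_right 0)" for a b
    using scaled_coeff_tendsto[of "\<lambda>S. \<pi> (\<lambda>i. i \<in> S)" T U i j a b] scaled_coeff_0[OF T]
    by (simp add: c_def m_def)
  \<comment> \<open>Coordinate j is set to \<i>; \<open>?d\<close> is then the coefficient of u and
    \<open>?u\<close> the root. The assumed strict inequality makes the limit of Im
    \<open>?u\<close> positive, so for some small \<epsilon> > 0 there is a zero inside the upper
    half-plane.\<close>
  let ?d = "\<lambda>\<epsilon>. c True False \<epsilon> + c True True \<epsilon> * \<i>"
  let ?u = "\<lambda>\<epsilon>. - (c False False \<epsilon> + c False True \<epsilon> * \<i>) / ?d \<epsilon>"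
  have d0: "of_real (m True False) + of_real (m True True) * \<i> \<noteq> 0"
    using neg by (auto simp: complex_eq_iff)
  have limd: "(?d \<longlongrightarrow> of_real (m True False) + of_real (m True True) * \<i>) (at_right 0)"
    by (intro tendsto_intros lim)
  have "((\<lambda>\<epsilon>. Im (?u \<epsilon>)) \<longlongrightarrow> Im (- (of_real (m False False) + of_real (m False True) * \<i>)
      / (of_real (m True False) + of_real (m True True) * \<i>))) (at_right 0)"
    by (intro tendsto_intros lim d0)
  moreover have "0 < Im (- (of_real (m False False) + of_real (m False True) * \<i>)
      / (of_real (m True False) + of_real (m True True) * \<i>))"
    unfolding Im_moebius using neg
    by (intro divide_pos_pos) (auto simp: sum_power2_gt_zero_iff)
  ultimately have "\<forall>\<^sub>F \<epsilon> in at_right 0. 0 < Im (?u \<epsilon>)"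
    by (rule order_tendstoD)
  moreover have "\<forall>\<^sub>F \<epsilon> in at_right 0. ?d \<epsilon> \<noteq> 0"
    using limd d0 by (rule tendsto_imp_eventually_ne)
  moreover have "\<forall>\<^sub>F \<epsilon>::real in at_right 0. 0 < \<epsilon>"
    by (rule eventually_at_right_less)
  ultimately have "\<forall>\<^sub>F \<epsilon> in at_right 0. 0 < Im (?u \<epsilon>) \<and> ?d \<epsilon> \<noteq> 0 \<and> 0 < \<epsilon>"
    by (intro eventually_conj)
  then obtain \<epsilon> where \<epsilon>: "0 < Im (?u \<epsilon>)" "?d \<epsilon> \<noteq> 0" "0 < \<epsilon>"
    using eventually_happens' trivial_limit_at_right_real by blast
  define z where "z = (\<lambda>l. if l \<in> T then \<i> / of_real \<epsilon> else if l \<in> U then \<i> * of_real \<epsilon>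
        else if l = i then ?u \<epsilon> else if l = j then \<i> else 1 + \<i> * of_real \<epsilon>)"
  have "c False False \<epsilon> + c True False \<epsilon> * ?u \<epsilon> + c False True \<epsilon> * \<i> + c True True \<epsilon> * ?u \<epsilon> * \<i>
      = (c False False \<epsilon> + c False True \<epsilon> * \<i>) + ?u \<epsilon> * ?d \<epsilon>"
    unfolding distrib_left by (simp only: ac_simps)
  also have "\<dots> = 0"
    using \<epsilon>(2) by simp
  finally have "gen_poly \<pi> z = 0"
    using gen_poly_scaled[OF ij T _ z_def, of \<pi>] \<epsilon> by (simp add: c_def)
  moreover have "0 < Im (z l)" for l
    using \<epsilon> by (simp add: z_def Im_divide_of_real)
  ultimately show False
    using sr by (auto simp: strong_rayleigh_def)
qed

text \<open>For the two by two table of joint masses of i and j, negative correlation reads m11 (m11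
  + m10 + m01 + m00) \<le> (m11 + m10) (m11 + m01), which cancels to m00 m11 \<le> m10 m01.\<close>

lemma strong_rayleigh_homogeneous_neg_corr:
  fixes \<pi> :: "('n::finite \<Rightarrow> bool) \<Rightarrow> real"
  assumes "prob_on_cube \<pi>" "homogeneous k \<pi>" "strong_rayleigh \<pi>"
  shows "homogeneous_neg_corr (\<lambda>S. \<pi> (\<lambda>i. i \<in> S)) k"
proof
  fix S :: "'n set"
  show "0 \<le> \<pi> (\<lambda>i. i \<in> S)"
    using assms by (simp add: prob_on_cube_def)
  show "card S = k" if "\<pi> (\<lambda>i. i \<in> S) \<noteq> 0"
    using assms(2) that by (auto simp: homogeneous_def)
next
  fix i j :: 'n and T U
  assume ij: "i \<noteq> j" "i \<notin> T \<union> U" "j \<notin> T \<union> U"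
  let ?\<mu> = "\<lambda>S. \<pi> (\<lambda>i. i \<in> S)"
  let ?M = "mass ?\<mu>"
  show "?M (insert i (insert j T)) U * ?M T U \<le> ?M (insert i T) U * ?M (insert j T) U"
  proof (cases "T \<inter> U = {}")
    case False
    then have *: "{S. T' \<subseteq> S \<and> S \<inter> U = {}} = {}" if "T \<subseteq> T'" for T'
      using that by blast
    have "?M T' U = 0" if "T \<subseteq> T'" for T'
      unfolding mass_def *[OF that] by simp
    then show ?thesis
      by (simp add: subset_insertI)
  next
    case True
    define m where "m = (\<lambda>a b. \<Sum>S | T \<subseteq> S \<and> S \<inter> U = {} \<and> (i \<in> S) = a \<and> (j \<in> S) = b. ?\<mu> S)"
    have m: "m False False * m True True \<le> m True False * m False True"
      unfolding m_def by (rule strong_rayleigh_bilinear[OF assms(3) ij(1) True ij(2,3)])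
    have 1: "m True True = ?M (insert i (insert j T)) U" "m True False = ?M (insert i T) (insert j U)"
      "m False True = ?M (insert j T) (insert i U)" "m False False = ?M T (insert i (insert j U))"
      by (auto simp: m_def mass_def intro!: sum.cong)
    have "?M T U = ?M (insert i T) U + ?M T (insert i U)"
      "?M (insert i T) U = ?M (insert j (insert i T)) U + ?M (insert i T) (insert j U)"
      "?M (insert j T) U = ?M (insert i (insert j T)) U + ?M (insert j T) (insert i U)"
      "?M T (insert i U) = ?M (insert j T) (insert i U) + ?M T (insert j (insert i U))"
      using ij by (auto intro!: mass_split)
    then have "?M (insert i T) U = m True True + m True False" "?M (insert j T) U = m True True + m False True"
      "?M T U = m True True + m True False + m False True + m False False"
      unfolding 1 by (simp_all add: insert_commute)
    then show ?thesis
      using m by (simp add: 1(1)[symmetric] algebra_simps)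
  qed
qed

section \<open>Hermitian matrices\<close>

lemma bounded_linear_matrix_vector_mult: "bounded_linear ((*v) (A :: complex^'n^'m))"
proof -
  have "linear ((*v) A)"
    by (rule linearI)
      (simp_all add: matrix_vector_right_distrib, simp add: matrix_vector_mult_def vec_eq_iff scaleR_sum_right)
  then show ?thesis
    by (simp add: linear_conv_bounded_linear)
qed

definition endo_of_matrix :: "complex^'d^'d \<Rightarrow> (complex^'d) endo" where
  "endo_of_matrix A = endo_of_blinfun (Blinfun ((*v) A))"

lemma endo_of_matrix_apply [simp]: "endo_of_matrix A \<cdot> v = A *v v"
  by (simp add: endo_of_matrix_def endo_of_blinfun_apply bounded_linear_matrix_vector_mult)

lemma linear_endo_of_matrix: "linear endo_of_matrix"
proof (rule linearI; rule endo_eqI)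
  fix A B :: "complex^'d^'d" and r v
  show "endo_of_matrix (A + B) \<cdot> v = (endo_of_matrix A + endo_of_matrix B) \<cdot> v"
    by (simp add: endo.add_left matrix_vector_mult_add_rdistrib)
  show "endo_of_matrix (r *\<^sub>R A) \<cdot> v = (r *\<^sub>R endo_of_matrix A) \<cdot> v"
    by (simp add: endo.scaleR_left matrix_vector_mult_def vec_eq_iff scaleR_sum_right)
qed

lemma norm_matrix_vector_le: "norm (A *v v) \<le> op_norm A * norm v"
  unfolding op_norm_def by (rule onorm[OF bounded_linear_matrix_vector_mult])

lemma op_norm_nonneg: "0 \<le> op_norm A"
  unfolding op_norm_def by (rule onorm_pos_le[OF bounded_linear_matrix_vector_mult])

lemma norm_endo_of_matrix_le: "norm (endo_of_matrix A) \<le> op_norm A"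
  by (rule norm_endo_bound) (simp_all add: op_norm_nonneg norm_matrix_vector_le)

lemma inner_complex_eq: "a \<bullet> b = Re (cnj a * b)"
  by (simp add: inner_complex_def)

text \<open>The Euclidean inner product of \<open>complex^'d\<close> as a real space is the real
  part of the Hermitian one; this links the matrix notions to \<open>endo\<close>.\<close>

lemma Re_quad_form: "Re (quad_form A v) = v \<bullet> (A *v v)"
  by (simp add: quad_form_def inner_vec_def inner_complex_eq del: complex_cnj_mult)

lemma hermitian_iff: "hermitian A \<longleftrightarrow> (\<forall>i j. cnj (A $ i $ j) = A $ j $ i)"
  unfolding hermitian_def by metis

lemma selfadjoint_endo_of_matrix:
  assumes "hermitian A"
  shows "selfadjoint (endo_of_matrix A)"
  unfolding selfadjoint_iff
proof (intro allI)
  fix x y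
  have A: "cnj (A $ i $ j) = A $ j $ i" for i j
    using assms by (simp add: hermitian_iff)
  have "(A *v x) \<bullet> y = Re (\<Sum>i\<in>UNIV. \<Sum>j\<in>UNIV. cnj (A $ i $ j) * cnj (x $ j) * y $ i)"
    by (simp add: inner_vec_def inner_complex_eq matrix_vector_mult_def sum_distrib_right)
  also have "\<dots> = Re (\<Sum>j\<in>UNIV. \<Sum>i\<in>UNIV. cnj (x $ j) * (A $ j $ i * y $ i))"
    by (subst sum.swap) (simp add: A mult_ac)
  also have "\<dots> = x \<bullet> (A *v y)"
    by (simp add: inner_vec_def inner_complex_eq matrix_vector_mult_def sum_distrib_left)
  finally show "(endo_of_matrix A \<cdot> x) \<bullet> y = x \<bullet> (endo_of_matrix A \<cdot> y)"
    by simp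
qed

lemma inner_square_selfadjoint: "selfadjoint A \<Longrightarrow> v \<bullet> (A \<cdot> A \<cdot> v) = (norm (A \<cdot> v))\<^sup>2"
  by (simp add: selfadjointD[symmetric] power2_norm_eq_inner)

lemma hermitian_inner_square:
  "hermitian A \<Longrightarrow> v \<bullet> ((A ** A) *v v) = (norm (A *v v))\<^sup>2"
  using inner_square_selfadjoint[OF selfadjoint_endo_of_matrix, of A v]
  by (simp add: matrix_vector_mul_assoc)

lemma loewner_square_norm_le:
  assumes "hermitian A" "hermitian B" "A ** A \<preceq>\<^sub>L B ** B"
  shows "norm (A *v v) \<le> norm (B *v v)"
proof -
  have "0 \<le> v \<bullet> ((B ** B - A ** A) *v v)"
    using assms(3) by (simp add: loewner_le_def psd_def Re_quad_form)
  then have "(norm (A *v v))\<^sup>2 \<le> (norm (B *v v))\<^sup>2"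
    by (simp add: matrix_vector_mult_diff_rdistrib inner_diff hermitian_inner_square assms(1,2))
  then show ?thesis
    by (rule power2_le_imp_le) simp
qed

lemma hermitian_diff: "hermitian A \<Longrightarrow> hermitian B \<Longrightarrow> hermitian (A - B)"
  by (simp add: hermitian_iff)

lemma hermitian_expect: "(\<And>x. hermitian (f x)) \<Longrightarrow> hermitian (expect \<pi> f)"
  by (simp add: hermitian_iff expect_def)

text \<open>A maximiser v of the Rayleigh quotient is an eigenvector. The form b is positive
  semidefinite and b v v = 0; if u = l v - X v were nonzero, a small move from v against u would
  make b negative.\<close>

lemma selfadjoint_eigenvector:
  fixes X :: "'a::euclidean_space endo"
  assumes X: "selfadjoint X"
  shows "\<exists>l v. v \<noteq> 0 \<and> X \<cdot> v = l *\<^sub>R v"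
proof -
  have "continuous_on (sphere 0 1) (\<lambda>v. v \<bullet> (X \<cdot> v))"
    by (intro continuous_intros bounded_linear.continuous_on[OF endo.bounded_linear_right])
  moreover have "sphere (0::'a) 1 \<noteq> {}" by simp
  ultimately have "\<exists>v\<in>sphere 0 1. \<forall>w\<in>sphere 0 1. w \<bullet> (X \<cdot> w) \<le> v \<bullet> (X \<cdot> v)"
    by (intro continuous_attains_sup compact_sphere)
  then obtain v where v: "norm v = 1" and max: "\<And>w. norm w = 1 \<Longrightarrow> w \<bullet> (X \<cdot> w) \<le> v \<bullet> (X \<cdot> v)"
    by auto
  define l where "l = v \<bullet> (X \<cdot> v)"
  define b where "b x y = l * (x \<bullet> y) - x \<bullet> (X \<cdot> y)" for x y
  have b_nonneg: "0 \<le> b w w" for w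
  proof (cases "w = 0")
    case False
    have "(w /\<^sub>R norm w) \<bullet> (X \<cdot> (w /\<^sub>R norm w)) \<le> l"
      unfolding l_def by (rule max) (simp add: False)
    then show ?thesis
      using False by (simp add: b_def endo.scaleR_right field_simps power2_norm_eq_inner[symmetric] power2_eq_square)
  qed (simp add: b_def)
  define u where "u = l *\<^sub>R v - X \<cdot> v"
  have bv: "b v v = 0"
    using v by (simp add: b_def l_def norm_eq_1)
  have "u = 0"
  proof (rule ccontr)
    assume "u \<noteq> 0"
    then have uu: "0 < u \<bullet> u" by simp
    \<comment> \<open>Small enough that the quadratic term s b(u,u) stays below the linear gain 2
      |u|^2; the 1 keeps the denominator positive.\<close>
    define s where "s = (u \<bullet> u) / (b u u + 1)"
    have s: "0 < s" "s * (b u u + 1) = u \<bullet> u"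
      using uu b_nonneg[of u] by (auto simp: s_def add_nonneg_pos intro!: divide_pos_pos)
    have bvu: "b u v = u \<bullet> u" "b v u = u \<bullet> u"
    proof -
      have "b u v = u \<bullet> (l *\<^sub>R v - X \<cdot> v)"
        by (simp add: b_def inner_diff_right)
      then show "b u v = u \<bullet> u"
        unfolding u_def[symmetric] .
      then show "b v u = u \<bullet> u"
        using selfadjointD[OF X, of v u] by (simp add: b_def inner_commute[of v u] inner_commute[of "X \<cdot> v" u])
    qed
    have "b (v - s *\<^sub>R u) (v - s *\<^sub>R u) = b v v - s * b u v - s * b v u + s * (s * b u u)"
      by (simp add: b_def endo.diff_right endo.scaleR_right inner_diff_left inner_diff_right algebra_simps)
    also have "\<dots> = s * (s * b u u - 2 * (u \<bullet> u))"
      by (simp add: bv bvu algebra_simps)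
    also have "\<dots> < 0"
    proof (rule mult_pos_neg[OF s(1)])
      have "s * b u u + s = u \<bullet> u" using s(2) by (simp add: distrib_left)
      then show "s * b u u - 2 * (u \<bullet> u) < 0" using s(1) uu by linarith
    qed
    finally show False
      using b_nonneg[of "v - s *\<^sub>R u"] by simp
  qed
  then have "X \<cdot> v = l *\<^sub>R v" by (simp add: u_def)
  moreover have "v \<noteq> 0" using v by auto
  ultimately show ?thesis by blast
qed

text \<open>Eigenvectors for distinct eigenvalues are orthogonal, hence independent. Finiteness is
  what gives \<open>Max\<close> in \<open>lambda_max\<close> its meaning.\<close>

lemma selfadjoint_finite_eigenvalues:
  fixes X :: "'a::euclidean_space endo"
  assumes X: "selfadjoint X"
  shows "finite {l. \<exists>v. v \<noteq> 0 \<and> X \<cdot> v = l *\<^sub>R v}" (is "finite ?L")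
proof -
  obtain v where v: "\<And>l. l \<in> ?L \<Longrightarrow> v l \<noteq> 0 \<and> X \<cdot> v l = l *\<^sub>R v l"
    using bchoice[of ?L "\<lambda>l v. v \<noteq> 0 \<and> X \<cdot> v = l *\<^sub>R v"] by auto
  have "v l \<bullet> v m = 0" if "l \<in> ?L" "m \<in> ?L" "l \<noteq> m" for l m
    using selfadjointD[OF X, of "v l" "v m"] v[OF that(1)] v[OF that(2)] that(3) by simp
  then have "pairwise orthogonal (v ` ?L)"
    by (auto simp: pairwise_def orthogonal_def)
  moreover have "0 \<notin> v ` ?L"
  proof
    assume "0 \<in> v ` ?L"
    then obtain l where "l \<in> ?L" "v l = 0" by (metis (no_types, lifting) imageE)
    then show False using v[of l] by simp
  qed
  ultimately have "finite (v ` ?L)"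
    by (intro independent_imp_finite pairwise_orthogonal_independent)
  moreover have "inj_on v ?L"
  proof (rule inj_onI)
    fix l m assume *: "l \<in> ?L" "m \<in> ?L" "v l = v m"
    then have "l *\<^sub>R v l = m *\<^sub>R v l" using v by metis
    then show "l = m" using v[OF *(1)] by simp
  qed
  ultimately show ?thesis by (rule finite_imageD)
qed

lemma of_real_vector_scalar: "of_real l *s v = l *\<^sub>R v" for v :: "complex^'d"
  by (simp add: vec_eq_iff scaleR_conv_of_real[symmetric])

lemma lambda_max_eigenvector:
  assumes "hermitian A"
  obtains v where "v \<noteq> 0" "A *v v = lambda_max A *\<^sub>R v"
proof -
  let ?L = "{l::real. \<exists>v. v \<noteq> 0 \<and> A *v v = complex_of_real l *s v}"
  have sa: "selfadjoint (endo_of_matrix A)"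
    using assms by (rule selfadjoint_endo_of_matrix)
  have "finite ?L" "?L \<noteq> {}"
    using selfadjoint_finite_eigenvalues[OF sa] selfadjoint_eigenvector[OF sa]
    by (simp_all add: of_real_vector_scalar)
  then have "lambda_max A \<in> ?L"
    unfolding lambda_max_def by (rule Max_in)
  then show ?thesis
    using that by (auto simp: of_real_vector_scalar)
qed

text \<open>Over the reals every eigenvalue of a Hermitian matrix has multiplicity at least two, with
  orthogonal eigenvectors \<open>u\<close> and \<open>\<i> u\<close>. This compensates for the real trace being twice
  the complex one.\<close>

lemma tr_exp_ge_lambda_max:
  assumes A: "hermitian A" and "0 \<le> \<theta>"
  shows "2 * exp (\<theta> * lambda_max A) \<le> tr (exp (\<theta> *\<^sub>R endo_of_matrix A))"
proof -
  obtain v where v: "v \<noteq> 0" "A *v v = lambda_max A *\<^sub>R v"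
    using lambda_max_eigenvector[OF A] .
  define u where "u = v /\<^sub>R norm v"
  have u: "norm u = 1" "A *v u = lambda_max A *\<^sub>R u"
    using v bounded_linear.linear[OF bounded_linear_matrix_vector_mult, THEN linear_scale, of A "inverse (norm v)" v]
    by (simp_all add: u_def)
  have "norm (\<i> *s u) = norm u"
    by (simp add: norm_vec_def norm_mult)
  moreover have "u \<bullet> (\<i> *s u) = 0"
    by (simp add: inner_vec_def inner_complex_def)
  moreover have "A *v (\<i> *s u) = lambda_max A *\<^sub>R (\<i> *s u)"
  proof -
    have "A *v (\<i> *s u) = \<i> *s (A *v u)"
      by (simp add: matrix_vector_mult_def vec_eq_iff sum_distrib_left mult_ac)
    also have "\<dots> = lambda_max A *\<^sub>R (\<i> *s u)"
      by (simp add: u(2) vec_eq_iff)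
    finally show ?thesis .
  qed
  ultimately show ?thesis
    using u by (intro tr_exp_ge_double_eigenvalue[of _ u "\<i> *s u"])
      (simp_all add: selfadjoint_scaleR selfadjoint_endo_of_matrix A endo.scaleR_left)
qed

section \<open>The choice of \<theta> and the conclusion\<close>

lemma harm_le_ln:
  assumes "k \<ge> 1"
  shows "harm k \<le> ln (exp 1 * real k)"
  \<comment> \<open>H_k - ln k is decreasing in k and equals 1 at k = 1.\<close>
  using euler_mascheroni_sequence_decreasing[of 1 k] assms by (simp add: ln_mult harm_def)

lemma bernstein_optimize:
  fixes p d V K L t :: real
  assumes bound: "\<And>\<theta>. 0 \<le> \<theta> \<Longrightarrow> \<theta> * (2 * K) < 3 \<Longrightarrow>
      p \<le> d * exp (4 * V * (\<theta>\<^sup>2 / 2 / (1 - \<theta> * (2 * K) / 3)) * L - \<theta> * t)"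
    and p: "p \<le> d" and nonneg: "0 \<le> V" "0 \<le> K" "0 \<le> L" and t: "0 < t"
  shows "p \<le> d * exp (- (t\<^sup>2 / (8 * V * L + 4/3 * K * t)))"
proof -
  define s where "s = 4 * V * L"
  define q where "q = s + 2 * K * t / 3"
  have s: "0 \<le> s" using nonneg by (simp add: s_def)
  have den: "8 * V * L + 4/3 * K * t = 2 * q" by (simp add: q_def s_def)
  consider "0 < s" | "s = 0" "0 < K" | "s = 0" "K = 0"
    using s nonneg by linarith
  then show ?thesis
  proof cases
    case 1
    have q: "0 < q" using 1 nonneg t by (simp add: q_def add_pos_nonneg)
    \<comment> \<open>Bernstein's choice: the denominator 1 - 2 K \<theta> / 3 becomes s/q, and the
      exponent collapses to -t^2 / (2 q).\<close>
    define \<theta> where "\<theta> = t / q"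
    have gap: "1 - \<theta> * (2 * K) / 3 = s / q"
      using q by (simp add: \<theta>_def q_def field_simps)
    have "0 < s / q" using 1 q by simp
    then have "\<theta> * (2 * K) < 3" using gap by linarith
    moreover have "0 \<le> \<theta>" using t q by (simp add: \<theta>_def)
    ultimately have "p \<le> d * exp (4 * V * (\<theta>\<^sup>2 / 2 / (s / q)) * L - \<theta> * t)"
      using bound[of \<theta>] gap by simp
    also have "4 * V * (\<theta>\<^sup>2 / 2 / (s / q)) * L = s * (\<theta>\<^sup>2 / 2 / (s / q))"
      by (simp add: s_def)
    also have "\<dots> = \<theta>\<^sup>2 * q / 2"
      using 1 by simp
    also have "\<theta>\<^sup>2 * q / 2 - \<theta> * t = - (t\<^sup>2 / (2 * q))"
      using q by (simp add: \<theta>_def power2_eq_square field_simps)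
    finally show ?thesis unfolding den .
  next
    case 2
    \<comment> \<open>For s = 0 the choice t/q = 3/(2 K) lies on the excluded boundary. Without a
      quadratic term half of it already gives the exponent -3 t / (4 K) = -t^2 / (2 q).\<close>
    have "p \<le> d * exp (s * ((3 / (4 * K))\<^sup>2 / 2 / (1 - 3 / (4 * K) * (2 * K) / 3)) - 3 / (4 * K) * t)"
      using bound[of "3 / (4 * K)"] 2 by (simp add: s_def mult_ac)
    also have "s * ((3 / (4 * K))\<^sup>2 / 2 / (1 - 3 / (4 * K) * (2 * K) / 3)) - 3 / (4 * K) * t = - (t\<^sup>2 / (2 * q))"
      using 2 t by (simp add: q_def power2_eq_square)
    finally show ?thesis unfolding den .
  next
    case 3
    \<comment> \<open>The denominator vanishes, the quotient is 0 by convention, and the trivial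
      bound \<open>p \<le> d\<close> remains.\<close>
    then have "q = 0" by (simp add: q_def)
    then show ?thesis unfolding den using p by simp
  qed
qed

theorem theorem2p8:
  fixes \<pi> :: "('n::finite \<Rightarrow> bool) \<Rightarrow> real"
    and f :: "('n \<Rightarrow> bool) \<Rightarrow> complex^'d::finite^'d"
    and C :: "'n \<Rightarrow> complex^'d^'d"
    and k :: nat and t :: real
  assumes "k \<ge> 1"
    and "prob_on_cube \<pi>" and "homogeneous k \<pi>" and "strong_rayleigh \<pi>"
    and "\<forall>x. hermitian (f x)" and "\<forall>i. hermitian (C i)"
    and "\<forall>x i. (f x - f (flip x i)) ** (f x - f (flip x i)) \<preceq>\<^sub>L C i ** C i"
    and "t > 0"
  shows "(\<Sum>x\<in>{x. lambda_max (f x - expect \<pi> f) > t}. \<pi> x)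
     \<le> real CARD('d) * exp (- (t\<^sup>2 /
          (8 * op_norm (expect \<pi> (\<lambda>x. \<Sum>i\<in>UNIV. (if x i then 1 else 0) *\<^sub>R (C i ** C i)))
             * ln (exp 1 * real k)
           + 4/3 * (MAX i\<in>UNIV. op_norm (C i)) * t)))"
proof -
  define \<mu> where "\<mu> S = \<pi> (\<lambda>i. i \<in> S)" for S
  define F where "F S = endo_of_matrix (f (\<lambda>i. i \<in> S))" for S
  define M where "M = expect \<pi> (\<lambda>x. \<Sum>i\<in>UNIV. (if x i then 1 else 0) *\<^sub>R (C i ** C i))"
  define K where "K = (MAX i\<in>UNIV. op_norm (C i))"
  define p where "p = (\<Sum>x\<in>{x. lambda_max (f x - expect \<pi> f) > t}. \<pi> x)"
  have \<pi>: "0 \<le> \<pi> x" "(\<Sum>x\<in>UNIV. \<pi> x) = 1" for x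
    using assms(2) by (auto simp: prob_on_cube_def)
  have herm: "hermitian (f x)" "hermitian (C i)" for x i
    using assms(5,6) by auto
  interpret homogeneous_neg_corr \<mu> k
    unfolding \<mu>_def by (rule strong_rayleigh_homogeneous_neg_corr[OF assms(2,3,4)])
  have P1: "P {} = 1"
    using \<pi>(2) by (simp add: P_def mass_def \<mu>_def sum_cube_eq_sum_sets)
  have E_empty: "E {} g = (\<Sum>S\<in>UNIV. \<mu> S *\<^sub>R g S)" for g :: "'n set \<Rightarrow> 'v::real_vector"
    by (simp add: E_def wsum_def P1)
  have K_ge: "op_norm (C i) \<le> K" for i
    unfolding K_def by (rule Max_ge) auto
  interpret lipschitz_endo \<mu> k F "\<lambda>i. endo_of_matrix (C i)" K "op_norm M"
  proof
    fix S i v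
    show "selfadjoint (F S)"
      unfolding F_def by (intro selfadjoint_endo_of_matrix herm)
    show "norm (endo_of_matrix (C i)) \<le> K"
      by (rule order_trans[OF norm_endo_of_matrix_le K_ge])
    show "0 \<le> op_norm M"
      by (rule op_norm_nonneg)
    show "norm ((F (insert i S) - F S) \<cdot> v) \<le> norm (endo_of_matrix (C i) \<cdot> v)"
    proof (cases "i \<in> S")
      case True
      then show ?thesis by (simp add: insert_absorb endo.zero_left)
    next
      case False
      let ?x = "\<lambda>l. l \<in> S"
      have x: "flip ?x i = (\<lambda>l. l \<in> insert i S)"
        using False by (auto simp: flip_def fun_eq_iff)
      have "norm ((f ?x - f (flip ?x i)) *v v) \<le> norm (C i *v v)"
        using assms(7) by (intro loewner_square_norm_le hermitian_diff herm) auto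
      then show ?thesis
        by (simp add: x F_def endo.diff_left matrix_vector_mult_diff_rdistrib norm_minus_commute)
    qed
    have "(\<Sum>l\<in>UNIV. marg {} l * (norm (C l *v v))\<^sup>2)
        = (\<Sum>S\<in>UNIV. \<mu> S * (\<Sum>l\<in>UNIV. (if l \<in> S then 1 else 0) * (norm (C l *v v))\<^sup>2))"
      unfolding E_empty sum_distrib_left sum_distrib_right real_scaleR_def
      by (subst sum.swap) (simp only: mult.assoc)
    also have "\<dots> = v \<bullet> (M *v v)"
    proof -
      have "v \<bullet> (M *v v) = v \<bullet> (endo_of_matrix M \<cdot> v)" by simp
      also have "endo_of_matrix M = (\<Sum>S\<in>UNIV. \<mu> S *\<^sub>R
          (\<Sum>l\<in>UNIV. (if l \<in> S then 1 else 0) *\<^sub>R endo_of_matrix (C l ** C l)))"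
        by (simp only: M_def expect_def sum_cube_eq_sum_sets \<mu>_def
            linear_sum[OF linear_endo_of_matrix] linear_scale[OF linear_endo_of_matrix])
      finally show ?thesis
        by (simp add: endo.sum_left endo.scaleR_left inner_sum_right hermitian_inner_square herm)
    qed
    also have "\<dots> \<le> norm v * (op_norm M * norm v)"
      by (rule order_trans[OF norm_cauchy_schwarz]) (intro mult_left_mono norm_matrix_vector_le norm_ge_zero)
    finally show "(\<Sum>l\<in>UNIV. marg {} l * (norm (endo_of_matrix (C l) \<cdot> v))\<^sup>2) \<le> op_norm M * (norm v)\<^sup>2"
      by (simp add: power2_eq_square mult_ac)
  qed
  have EF: "E {} F = endo_of_matrix (expect \<pi> f)"
    by (simp add: E_empty F_def expect_def sum_cube_eq_sum_sets \<mu>_def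
        linear_sum[OF linear_endo_of_matrix] linear_scale[OF linear_endo_of_matrix])
  have "p \<le> real CARD('d) * exp (4 * op_norm M * (\<theta>\<^sup>2 / 2 / (1 - \<theta> * (2 * K) / 3)) * ln (exp 1 * real k) - \<theta> * t)"
    if \<theta>: "0 \<le> \<theta>" "\<theta> * (2 * K) < 3" for \<theta>
  proof -
    define h where "h = \<theta>\<^sup>2 / 2 / (1 - \<theta> * (2 * K) / 3)"
    have h: "0 \<le> h"
      unfolding h_def using \<theta> by (intro divide_nonneg_nonneg) auto
    let ?X = "\<lambda>x. f x - expect \<pi> f"
    let ?\<Phi> = "\<lambda>x. tr (exp (\<theta> *\<^sub>R endo_of_matrix (?X x)))"
    have X: "hermitian (?X x)" for x
      by (intro hermitian_diff hermitian_expect herm)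
    \<comment> \<open>Markov's inequality for the trace exponential. The factor 2 cancels against
      the real dimension \<open>2 * CARD('d)\<close>, the trace of the identity.\<close>
    have "p * (2 * exp (\<theta> * t)) = (\<Sum>x | lambda_max (?X x) > t. \<pi> x * (2 * exp (\<theta> * t)))"
      by (simp add: p_def sum_distrib_right)
    also have "\<dots> \<le> (\<Sum>x | lambda_max (?X x) > t. \<pi> x * ?\<Phi> x)"
    proof (intro sum_mono mult_left_mono \<pi>)
      fix x assume "x \<in> {x. lambda_max (?X x) > t}"
      then have "2 * exp (\<theta> * t) \<le> 2 * exp (\<theta> * lambda_max (?X x))"
        using \<theta> by (simp add: mult_left_mono)
      also have "\<dots> \<le> ?\<Phi> x"
        by (rule tr_exp_ge_lambda_max[OF X \<theta>(1)])
      finally show "2 * exp (\<theta> * t) \<le> ?\<Phi> x" .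
    qed
    also have "\<dots> \<le> (\<Sum>x\<in>UNIV. \<pi> x * ?\<Phi> x)"
      using X by (intro sum_mono2 mult_nonneg_nonneg \<pi> tr_exp_nonneg selfadjoint_scaleR
          selfadjoint_endo_of_matrix) auto
    also have "\<dots> = E {} (\<lambda>S. tr (exp (0 + \<theta> *\<^sub>R (F S - E {} F))))"
      unfolding EF unfolding E_empty
      by (simp add: F_def sum_cube_eq_sum_sets \<mu>_def linear_diff[OF linear_endo_of_matrix])
    also have "\<dots> \<le> exp (4 * op_norm M * h * harm (k - card ({} :: 'n set))) * tr (exp (0 :: (complex^'d) endo))"
      by (rule conditional_tr_exp_le[OF \<theta> h_def]) (simp_all add: P1)
    also have "\<dots> = 2 * real CARD('d) * exp (4 * op_norm M * h * harm k)"
      by simp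
    also have "\<dots> \<le> 2 * real CARD('d) * exp (4 * op_norm M * h * ln (exp 1 * real k))"
      using h op_norm_nonneg[of M] harm_le_ln[OF assms(1)] by (simp add: mult_left_mono)
    finally show ?thesis
      by (simp add: h_def exp_diff field_simps)
  qed
  moreover have "p \<le> real CARD('d)"
  proof -
    have "p \<le> (\<Sum>x\<in>UNIV. \<pi> x)"
      unfolding p_def by (rule sum_mono2) (auto simp: \<pi>)
    also have "\<dots> \<le> real CARD('d)"
      using zero_less_card_finite[where 'a='d] by (simp add: \<pi>(2) Suc_le_eq)
    finally show ?thesis .
  qed
  moreover have "0 \<le> ln (exp 1 * real k)"
    using assms(1) by (simp add: ln_mult)
  ultimately have "p \<le> real CARD('d) * exp (- (t\<^sup>2 / (8 * op_norm M * ln (exp 1 * real k) + 4/3 * K * t)))"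
    using assms(8) by (intro bernstein_optimize op_norm_nonneg K_nonneg)
  then show ?thesis
    by (simp only: p_def M_def K_def)
qed

end
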